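(* Let $T$ be a tree whose maximum split-set(s) have cardinality $m\in\{1,2\}$. Suppose that for each maximum split-set $M$ of $T$, every component of $T-M$ is uniquely radial. Then $i_{\operatorname{bn}}(T)=\gamma_{b}(T)+1$.
   Context: A broadcast on a connected graph $G=(V,E)$ is a function $f:V\to\{0,1,\dots,\operatorname{diam}(G)\}$ with $f(v)\le e(v)$ (the eccentricity of $v$) for all $v$ if $|V|\ge 2$, and $f(v)=1$ if $V=\{v\}$. Its cost is $\sigma(f)=\sum_{v}f(v)$, and $V_f^+=\{v:f(v)>0\}$. A vertex $u$ hears $f$ from $v\in V_f^+$ if $d(u,v)\le f(v)$; $f$ is dominating if every vertex hears $f$ from some vertex of $V_f^+$. $\gamma_b(G)$ is the minimum cost of a dominating broadcast; a dominating broadcast of that cost is a $\gamma_b$-broadcast. A tree $T$ is radial if $\gamma_b(T)=\operatorname{rad}(T)$, and uniquely radial if it is radial and has a unique $\gamma_b$-broadcast (equivalently, for trees of even diameter, every $\gamma_b$-broadcast has exactly one broadcasting vertex, namely the central vertex broadcasting with strength $\operatorname{rad}(T)$). A broadcast $f$ is bn-independent if every vertex $x$ that hears $f$ from more than one vertex of $V_f^+$ satisfies $d(x,u)\ge f(u)$ for all $u\in V_f^+$; it is maximal bn-independent if it is bn-independent and there is no bn-independent broadcast $g\neq f$ with $g(v)\ge f(v)$ for all $v$. $i_{\operatorname{bn}}(G)$ is the minimum cost of a maximal bn-independent broadcast on $G$. Split-sets: let $T$ be a tree with diametrical path $P$ and $M\subseteq E(P)$, $|M|=m\ge1$; let $T_1,\dots,T_{m+1}$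 be the components of $T-M$ and $P_i$ the subpath of $P$ in $T_i$. $M$ is a split-set if each $P_i$ has even, positive length and is a diametrical path of $T_i$; a maximum split-set is a split-set of maximum cardinality (this cardinality does not depend on the chosen diametrical path). *)

theory Defs
  imports "Graph_Theory.Graph_Theory"
begin

text \<open>
  A finite simple graph is an instance of the locale \<^locale>\<open>graph\<close>, in which an undirected edge
  \<open>uv\<close> is a pair of opposite arcs. Such a pair is a directed cycle of length 2, so the
  predicate \<^const>\<open>tree\<close>, which forbids every directed cycle, is not the notion of an
  undirected tree. In a simple graph the undirected cycles are the directed ones of length at least 3.
\<close>

definition undirected_tree :: "('a, 'b) pre_digraph \<Rightarrow> bool" where
  "undirected_tree G \<longleftrightarrow>
     graph G \<and> Digraph_Component.connected G \<and>
     \<not> (\<exists>p. pre_digraph.cycle G p \<and> 3 \<le> length p)"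


subsection \<open>Distance\<close>

text \<open>Unspecified if \<open>v\<close> cannot be reached from \<open>u\<close>; only used on connected graphs.\<close>

definition gdist :: "('a, 'b) pre_digraph \<Rightarrow> 'a \<Rightarrow> 'a \<Rightarrow> nat" where
  "gdist G u v = (LEAST n. \<exists>p. pre_digraph.awalk G u p v \<and> length p = n)"

definition ecc :: "('a, 'b) pre_digraph \<Rightarrow> 'a \<Rightarrow> nat" where
  "ecc G v = Max (gdist G v ` verts G)"

definition diam :: "('a, 'b) pre_digraph \<Rightarrow> nat" where
  "diam G = Max (ecc G ` verts G)"

definition rad :: "('a, 'b) pre_digraph \<Rightarrow> nat" where
  "rad G = Min (ecc G ` verts G)"


subsection \<open>Broadcasts\<close>

text \<open>
  A function on the vertex set is represented by a total function that is 0 elsewhere, so that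
  equality of broadcasts is equality of functions. On a one-vertex graph, where the diameter is 0,
  the value 1 is prescribed by convention.
\<close>

definition broadcast :: "('a, 'b) pre_digraph \<Rightarrow> ('a \<Rightarrow> nat) \<Rightarrow> bool" where
  "broadcast G f \<longleftrightarrow>
     (\<forall>v. v \<notin> verts G \<longrightarrow> f v = 0) \<and>
     (if card (verts G) = 1 then \<forall>v\<in>verts G. f v = 1
      else \<forall>v\<in>verts G. f v \<le> diam G \<and> f v \<le> ecc G v)"

definition cost :: "('a, 'b) pre_digraph \<Rightarrow> ('a \<Rightarrow> nat) \<Rightarrow> nat" where
  "cost G f = (\<Sum>v\<in>verts G. f v)"

definition broadcasting :: "('a, 'b) pre_digraph \<Rightarrow> ('a \<Rightarrow> nat) \<Rightarrow> 'a set" where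
  "broadcasting G f = {v \<in> verts G. 0 < f v}"

definition hears_from :: "('a, 'b) pre_digraph \<Rightarrow> ('a \<Rightarrow> nat) \<Rightarrow> 'a \<Rightarrow> 'a \<Rightarrow> bool" where
  "hears_from G f u v \<longleftrightarrow> v \<in> broadcasting G f \<and> gdist G u v \<le> f v"

definition dominating :: "('a, 'b) pre_digraph \<Rightarrow> ('a \<Rightarrow> nat) \<Rightarrow> bool" where
  "dominating G f \<longleftrightarrow> (\<forall>u\<in>verts G. \<exists>v. hears_from G f u v)"

definition gamma_b :: "('a, 'b) pre_digraph \<Rightarrow> nat" where
  "gamma_b G = (LEAST c. \<exists>f. broadcast G f \<and> dominating G f \<and> cost G f = c)"

definition gamma_b_broadcast :: "('a, 'b) pre_digraph \<Rightarrow> ('a \<Rightarrow> nat) \<Rightarrow> bool" where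
  "gamma_b_broadcast G f \<longleftrightarrow> broadcast G f \<and> dominating G f \<and> cost G f = gamma_b G"

definition radial :: "('a, 'b) pre_digraph \<Rightarrow> bool" where
  "radial G \<longleftrightarrow> gamma_b G = rad G"

definition uniquely_radial :: "('a, 'b) pre_digraph \<Rightarrow> bool" where
  "uniquely_radial G \<longleftrightarrow> radial G \<and> (\<exists>!f. gamma_b_broadcast G f)"

definition bn_independent :: "('a, 'b) pre_digraph \<Rightarrow> ('a \<Rightarrow> nat) \<Rightarrow> bool" where
  "bn_independent G f \<longleftrightarrow>
     broadcast G f \<and>
     (\<forall>x\<in>verts G. 1 < card {v. hears_from G f x v} \<longrightarrow>
        (\<forall>u\<in>broadcasting G f. f u \<le> gdist G x u))"

definition maximal_bn_independent :: "('a, 'b) pre_digraph \<Rightarrow> ('a \<Rightarrow> nat) \<Rightarrow> bool" where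
  "maximal_bn_independent G f \<longleftrightarrow>
     bn_independent G f \<and>
     \<not> (\<exists>g. bn_independent G g \<and> g \<noteq> f \<and> (\<forall>v\<in>verts G. f v \<le> g v))"

definition i_bn :: "('a, 'b) pre_digraph \<Rightarrow> nat" where
  "i_bn G = (LEAST c. \<exists>f. maximal_bn_independent G f \<and> cost G f = c)"


subsection \<open>Split-sets\<close>

definition diametrical_path :: "('a, 'b) pre_digraph \<Rightarrow> 'a vwalk \<Rightarrow> bool" where
  "diametrical_path G p \<longleftrightarrow>
     vpath p G \<and> vwalk_length p = gdist G (hd p) (last p) \<and> gdist G (hd p) (last p) = diam G"

text \<open>Sets of edges are sets of two-element vertex sets, so that cardinalities count undirected edges.\<close>

definition path_edges :: "'a vwalk \<Rightarrow> 'a set set" where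
  "path_edges p = (\<lambda>(u, v). {u, v}) ` set (vwalk_arcs p)"

definition del_edges :: "('a, 'b) pre_digraph \<Rightarrow> 'a set set \<Rightarrow> ('a, 'b) pre_digraph" where
  "del_edges G M = G\<lparr>arcs := {e \<in> arcs G. {tail G e, head G e} \<notin> M}\<rparr>"

text \<open>In a graph, arcs come in opposite pairs, so the strongly connected components are the components.\<close>

abbreviation components :: "('a, 'b) pre_digraph \<Rightarrow> ('a, 'b) pre_digraph set" where
  "components G \<equiv> pre_digraph.sccs G"

text \<open>
  The subpath of \<open>p\<close> in a component \<open>H\<close> of \<open>T - M\<close>: since \<open>T\<close> is a tree and \<open>M\<close> consists of edges
  of \<open>p\<close>, the vertices of \<open>p\<close> in \<open>H\<close> are consecutive on \<open>p\<close>.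
\<close>

definition subpath_in :: "'a vwalk \<Rightarrow> ('a, 'b) pre_digraph \<Rightarrow> 'a vwalk" where
  "subpath_in p H = filter (\<lambda>v. v \<in> verts H) p"

definition split_set_on :: "('a, 'b) pre_digraph \<Rightarrow> 'a vwalk \<Rightarrow> 'a set set \<Rightarrow> bool" where
  "split_set_on T p M \<longleftrightarrow>
     diametrical_path T p \<and> M \<subseteq> path_edges p \<and> 1 \<le> card M \<and>
     (\<forall>H\<in>components (del_edges T M).
        even (vwalk_length (subpath_in p H)) \<and>
        0 < vwalk_length (subpath_in p H) \<and>
        diametrical_path H (subpath_in p H))"

definition split_set :: "('a, 'b) pre_digraph \<Rightarrow> 'a set set \<Rightarrow> bool" where
  "split_set T M \<longleftrightarrow> (\<exists>p. split_set_on T p M)"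

definition maximum_split_set :: "('a, 'b) pre_digraph \<Rightarrow> 'a set set \<Rightarrow> bool" where
  "maximum_split_set T M \<longleftrightarrow> split_set T M \<and> (\<forall>M'. split_set T M' \<longrightarrow> card M' \<le> card M)"

end

(*
  A dominating broadcast f covers the tree T by balls. Merge balls as long as several of them fit in
  one ball whose radius is the sum of theirs. Once this is impossible, the four-point condition forces
  the remaining balls to be disjoint and to be strung along one diametrical path, which passes through
  every centre. So if k >= 2 balls remain, then the edges between them form a split-set and
  diam T = 2 * cost f + k - 1; if one ball remains, cost f >= rad T. Conversely, the centres of the
  components of T - M show that 2 * gamma_b T + card M <= diam T for each split-set M.

  With m <= 2 this gives rad T <= gamma_b T + 1, and the central vertex broadcasting with strength
  rad T is maximal bn-independent, so i_bn T <= gamma_b T + 1. A maximal bn-independent f is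
  dominating; if its cost were gamma_b T, the split-set obtained from it would be maximum, and by
  unique radiality f would have one broadcasting vertex in each component, i.e. nothing was merged.
  But then raising any value of f by 1 keeps f bn-independent.
*)

theory Submission
  imports Defs
begin

section \<open>Tree metrics\<close>

text \<open>In a tree metric a set of diameter at most \<open>2 * n\<close> lies in one ball of
  radius \<open>n\<close> (\<open>ex_center\<close>). Hence a family of balls that cannot be merged
  contains two points further apart than twice the sum of all its radii, although these points lie
  in just two of its balls. This one inequality shapes the chain of balls. For two balls it gives
  disjointness. For a ball with three neighbours, the neighbour that the two points miss has radius
  at least 1, which pays for both connecting edges, so three neighbours are impossible. For three
  balls in a row it misses straightness by one unit, and only the parity of distances in a bipartite
  graph removes this unit; this is why \<open>bipartite\<close> stands next to the four-point
  condition. Both bounds on \<open>m\<close> enter through the radius: \<open>m \<ge> 1\<close>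
  forces \<open>rad T > gamma_b T\<close>, which excludes a single remaining ball, and
  \<open>m \<le> 2\<close> keeps rounding within \<open>gamma_b T + 1\<close>.\<close>

locale tree_metric =
  fixes V :: "'a set" and D :: "'a \<Rightarrow> 'a \<Rightarrow> nat"
  assumes finite_V: "finite V"
    and D_eq_0: "\<lbrakk>x \<in> V; y \<in> V\<rbrakk> \<Longrightarrow> D x y = 0 \<longleftrightarrow> x = y"
    and D_sym: "\<lbrakk>x \<in> V; y \<in> V\<rbrakk> \<Longrightarrow> D x y = D y x"
    and D_triangle: "\<lbrakk>x \<in> V; y \<in> V; z \<in> V\<rbrakk> \<Longrightarrow> D x z \<le> D x y + D y z"
    and geodesic: "\<lbrakk>x \<in> V; y \<in> V; k \<le> D x y\<rbrakk> \<Longrightarrow> \<exists>z\<in>V. D x z = k \<and> D x z + D z y = D x y"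
    and four_point: "\<lbrakk>x \<in> V; y \<in> V; z \<in> V; w \<in> V\<rbrakk>
      \<Longrightarrow> D x y + D z w \<le> max (D x z + D y w) (D x w + D y z)"
    and bipartite: "\<lbrakk>x \<in> V; y \<in> V; z \<in> V; D x y = 1\<rbrakk> \<Longrightarrow> D x z \<noteq> D y z"
begin

lemma D_same [simp]: "x \<in> V \<Longrightarrow> D x x = 0"
  using D_eq_0 by blast

text \<open>One step along a geodesic from \<open>x\<close> to \<open>y\<close> changes the
  distances to \<open>y\<close> and to \<open>z\<close> by exactly one each, so the parity of the
  sum is preserved.\<close>

lemma even_perimeter:
  assumes "x \<in> V" "y \<in> V" "z \<in> V"
  shows "even (D x y + D y z + D x z)"
  using assms
proof (induction "D x y" arbitrary: x)
  case 0
  then show ?case using D_eq_0 by auto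
next
  case (Suc n)
  obtain w where w: "w \<in> V" "D x w = 1" "D x w + D w y = D x y"
    using geodesic[of x y 1] Suc.hyps(2) Suc.prems by auto
  have "even (D w y + D y z + D w z)"
    using Suc.hyps(1)[of w] w Suc.hyps(2) Suc.prems by simp
  moreover have "D x z \<noteq> D w z" using bipartite[of x w z] w Suc.prems by blast
  moreover have "D x z \<le> 1 + D w z" "D w z \<le> 1 + D x z"
    using D_triangle[of x w z] D_triangle[of w x z] D_sym[of w x] w Suc.prems by auto
  ultimately show ?case using w by presburger
qed

text \<open>\<open>D x z + D y w\<close> counts the segment from \<open>y\<close> to
  \<open>z\<close> twice, \<open>D x y + D z w\<close> omits it. As \<open>y \<noteq> z\<close>, the
  maximum in the four-point condition is therefore \<open>D x w + D y z\<close>. With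
  \<open>y = z\<close> the path could turn back.\<close>

lemma between_concat:
  assumes "x \<in> V" "y \<in> V" "z \<in> V" "w \<in> V" "y \<noteq> z"
    and "D x z = D x y + D y z" "D y w = D y z + D z w"
  shows "D x w = D x y + D y z + D z w"
proof -
  have "0 < D y z" using D_eq_0 assms by auto
  then have "D x y + D y z + D z w \<le> D x w"
    using four_point[of x z y w] assms D_sym[of z y] by auto
  then show ?thesis using D_triangle[of x y w] assms by simp
qed

text \<open>Both pairings of \<open>x\<close>, \<open>y\<close> with \<open>u\<close>,
  \<open>w\<close> have sum \<open>D x y\<close>, so the four-point condition leaves no room for
  \<open>D u w > 0\<close>.\<close>

lemma between_unique:
  assumes "x \<in> V" "y \<in> V" "u \<in> V" "w \<in> V"
    and "D x u + D u y = D x y" "D x w + D w y = D x y" "D x u = D x w"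
  shows "u = w"
proof -
  have "D x y + D u w \<le> D x y"
    using four_point[of x y u w] assms D_sym[of y w] D_sym[of y u] by auto
  then show ?thesis using D_eq_0 assms by auto
qed

text \<open>The centre is the midpoint of a pair of points of \<open>X\<close> at maximal distance.\<close>

lemma ex_center:
  assumes "X \<subseteq> V" "X \<noteq> {}" "\<And>x y. \<lbrakk>x \<in> X; y \<in> X\<rbrakk> \<Longrightarrow> D x y \<le> 2 * n"
  shows "\<exists>w\<in>V. \<forall>x\<in>X. D x w \<le> n"
proof -
  have fin: "finite X" using assms finite_V finite_subset by blast
  define S where "S = (\<lambda>(x, y). D x y) ` (X \<times> X)"
  have S: "finite S" "S \<noteq> {}" using fin assms by (auto simp: S_def)
  obtain p q where pq: "p \<in> X" "q \<in> X" "D p q = Max S"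
    using Max_in[OF S] by (auto simp: S_def)
  have max: "D x y \<le> D p q" if "x \<in> X" "y \<in> X" for x y
    using Max_ge[OF S(1), of "D x y"] that pq by (force simp: S_def)
  have pqV: "p \<in> V" "q \<in> V" using pq assms by auto
  obtain w where w: "w \<in> V" "D p w = D p q div 2" "D p w + D w q = D p q"
    using geodesic[OF pqV, of "D p q div 2"] by auto
  \<comment> \<open>As \<open>D x p\<close> and \<open>D x q\<close> are at most
    \<open>D p q\<close>, the four-point condition leaves \<open>D x w \<le> D w q\<close>, which is
    half of \<open>D p q\<close> rounded up. The even bound \<open>2 * n\<close> absorbs the
    rounding.\<close>
  have "D x w \<le> n" if x: "x \<in> X" for x
  proof -
    have "D x w + D p q \<le> max (D x p + D w q) (D x q + D w p)"
      using four_point[of x w p q] x w pq assms by blast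
    moreover have "D x p \<le> D p q" "D x q \<le> D p q" "D p q \<le> 2 * n"
      using max x pq(1,2) assms(3)[of p q] by auto
    moreover have "D w p = D p w" using D_sym w pq assms by auto
    ultimately show ?thesis using w by auto
  qed
  then show ?thesis using w by blast
qed

lemma crossing_edge:
  assumes "U \<subseteq> V" "u \<in> U" "v \<in> V" "v \<notin> U"
  shows "\<exists>x\<in>U. \<exists>y\<in>V - U. D x y = 1"
  using assms(2-)
proof (induction "D u v" arbitrary: u)
  case 0
  then show ?case using D_eq_0 assms(1) by (metis subsetD)
next
  case (Suc n)
  then obtain w where w: "w \<in> V" "D u w = 1" "D u w + D w v = D u v"
    using geodesic[of u v 1] assms(1) by (metis One_nat_def Suc_leI subsetD zero_less_Suc)
  show ?case
  proof (cases "w \<in> U")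
    case True
    then show ?thesis using Suc.hyps(1)[of w] Suc.hyps(2) Suc.prems w by simp
  next
    case False
    then show ?thesis using Suc.prems w by blast
  qed
qed

text \<open>Each further step is glued on by \<open>between_concat\<close>, the shared segment being
  the step before it; \<open>neq\<close> makes that segment nondegenerate.\<close>

lemma local_geodesic:
  fixes y :: "nat \<Rightarrow> 'a"
  assumes V: "\<And>i. i \<le> n \<Longrightarrow> y i \<in> V"
    and neq: "\<And>i. i < n \<Longrightarrow> y i \<noteq> y (Suc i)"
    and loc: "\<And>i. Suc i < n \<Longrightarrow>
      D (y i) (y (Suc (Suc i))) = D (y i) (y (Suc i)) + D (y (Suc i)) (y (Suc (Suc i)))"
    and "i \<le> j" "j \<le> n"
  shows "D (y i) (y j) = (\<Sum>l = i..<j. D (y l) (y (Suc l)))"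
proof -
  have ext: "D (y i) (y (Suc j)) = D (y i) (y j) + D (y j) (y (Suc j))"
    if "i \<le> j" "Suc j \<le> n" for j
    using that
  proof (induction j rule: dec_induct)
    case base
    then show ?case using V by simp
  next
    case (step j)
    then show ?case
      using between_concat[of "y i" "y j" "y (Suc j)" "y (Suc (Suc j))"] V neq loc by auto
  qed
  show ?thesis using \<open>i \<le> j\<close> \<open>j \<le> n\<close>
  proof (induction j rule: dec_induct)
    case base
    then show ?case using V by simp
  next
    case (step j)
    then show ?case using ext[of j] by simp
  qed
qed

text \<open>The points are chosen separately for each distance; the four-point condition for
  \<open>x\<close>, \<open>z\<close> and two of them shows that they fit together into one
  path.\<close>

lemma ex_geodesic_path:
  assumes "x \<in> V" "z \<in> V"
  shows "\<exists>pos. (\<forall>n\<le>D x z. pos n \<in> V \<and> D x (pos n) = n \<and> n + D (pos n) z = D x z) \<and>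
    (\<forall>m n. m \<le> n \<longrightarrow> n \<le> D x z \<longrightarrow> D (pos m) (pos n) = n - m)"
proof -
  have "\<exists>u. n \<le> D x z \<longrightarrow> u \<in> V \<and> D x u = n \<and> n + D u z = D x z" for n
    using geodesic[OF assms, of n] by auto
  then obtain pos where pos: "\<And>n. n \<le> D x z \<Longrightarrow> pos n \<in> V \<and> D x (pos n) = n \<and> n + D (pos n) z = D x z"
    by metis
  have "D (pos m) (pos n) = n - m" if "m \<le> n" "n \<le> D x z" for m n
  proof -
    have *: "pos m \<in> V" "pos n \<in> V" "D x (pos m) = m" "D x (pos n) = n"
      "D z (pos m) = D x z - m" "D z (pos n) = D x z - n"
      using pos[of m] pos[of n] that D_sym[of z "pos m"] D_sym[of z "pos n"] assms by auto
    then have "D x z + D (pos m) (pos n) \<le> max (m + (D x z - n)) (n + (D x z - m))"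
      using four_point[of x z "pos m" "pos n"] assms by simp
    then have "D (pos m) (pos n) \<le> n - m" using that by (simp add: max_def split: if_splits)
    then show ?thesis using D_triangle[of x "pos m" "pos n"] * assms by simp
  qed
  then show ?thesis using pos by blast
qed

end

section \<open>Incompressible covers and the chain of their centres\<close>

text \<open>
  No two or more of the balls \<open>D v c \<le> R c\<close> with \<open>c \<in> C\<close> can be replaced by a single ball whose
  radius is the sum of theirs.
\<close>

locale incompressible_cover = tree_metric +
  fixes C :: "'a set" and R :: "'a \<Rightarrow> nat"
  assumes C_subset: "C \<subseteq> V"
    and R_pos: "c \<in> C \<Longrightarrow> 0 < R c"
    and cover: "v \<in> V \<Longrightarrow> \<exists>c\<in>C. D v c \<le> R c"
    and incompressible: "\<lbrakk>S \<subseteq> C; 2 \<le> card S; w \<in> V\<rbrakk> \<Longrightarrow>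
      \<exists>c\<in>S. \<exists>v\<in>V. D v c \<le> R c \<and> sum R S < D v w"
begin

lemma C_in_V: "c \<in> C \<Longrightarrow> c \<in> V"
  using C_subset by blast

lemma finite_C: "finite C"
  using C_subset finite_V finite_subset by blast

text \<open>If the union of the balls had diameter at most \<open>2 * sum R S\<close>, its centre
  would contradict \<open>incompressible\<close>. Two points further apart cannot share a ball,
  whose diameter is at most \<open>2 * R c\<close>. The lemma is applied to sets of two, three and
  four centres.\<close>

lemma far_pair:
  assumes "S \<subseteq> C" "2 \<le> card S"
  shows "\<exists>c\<in>S. \<exists>c'\<in>S. c \<noteq> c' \<and> (\<exists>v\<in>V. \<exists>w\<in>V. D v c \<le> R c \<and> D w c' \<le> R c' \<and> 2 * sum R S < D v w)"
proof -
  define X where "X = {v \<in> V. \<exists>c\<in>S. D v c \<le> R c}"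
  have fS: "finite S" using assms finite_C finite_subset by blast
  obtain s where s: "s \<in> S" using assms by fastforce
  then have "s \<in> X" using assms C_in_V by (auto simp: X_def intro!: bexI[of _ s])
  have "\<not> (\<forall>x\<in>X. \<forall>y\<in>X. D x y \<le> 2 * sum R S)"
  proof
    assume "\<forall>x\<in>X. \<forall>y\<in>X. D x y \<le> 2 * sum R S"
    then obtain w where "w \<in> V" "\<forall>x\<in>X. D x w \<le> sum R S"
      using ex_center[of X "sum R S"] \<open>s \<in> X\<close> by (auto simp: X_def)
    then show False using incompressible[OF assms, of w] by (fastforce simp: X_def)
  qed
  then obtain v w c c' where *: "v \<in> V" "w \<in> V" "c \<in> S" "c' \<in> S" "D v c \<le> R c" "D w c' \<le> R c'"
    "2 * sum R S < D v w" by (auto simp: X_def not_le)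
  have "c \<noteq> c'"
  proof
    assume "c = c'"
    then have "D v w \<le> R c + R c"
      using D_triangle[of v c w] D_sym[of w c] * C_in_V assms by fastforce
    moreover have "R c \<le> sum R S" using * fS by (simp add: member_le_sum)
    ultimately show False using * by simp
  qed
  then show ?thesis using * by blast
qed

lemma triangle_balls:
  assumes "c \<in> V" "c' \<in> V" "v \<in> V" "w \<in> V" "D v c \<le> R c" "D w c' \<le> R c'"
  shows "D v w \<le> R c + D c c' + R c'"
  using D_triangle[of v c w] D_triangle[of c c' w] D_sym[of w c'] assms by simp

text \<open>The far points of \<open>{c, c'}\<close> are at distance at most
  \<open>R c + D c c' + R c'\<close>, and this must exceed \<open>2 * (R c + R c')\<close>.\<close>

lemma separated:
  assumes "c \<in> C" "c' \<in> C" "c \<noteq> c'"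
  shows "R c + R c' < D c c'"
proof -
  obtain d d' v w where *: "d \<in> {c, c'}" "d' \<in> {c, c'}" "d \<noteq> d'" "v \<in> V" "w \<in> V"
    "D v d \<le> R d" "D w d' \<le> R d'" "2 * sum R {c, c'} < D v w"
    using far_pair[of "{c, c'}"] assms by auto
  have "D v w \<le> R d + D d d' + R d'"
    using triangle_balls[of d d' v w] * assms C_in_V by auto
  moreover have "D d d' = D c c'" "R d + R d' = R c + R c'"
    using * assms D_sym[of c c'] C_in_V by auto
  ultimately show ?thesis using *(8) assms by simp
qed

text \<open>The least distance that \<open>separated\<close> permits: the geodesic between the
  centres passes from one ball to the other along a single edge.\<close>

definition adjacent :: "'a \<Rightarrow> 'a \<Rightarrow> bool" where
  "adjacent c c' \<longleftrightarrow> c \<noteq> c' \<and> D c c' = R c + R c' + 1"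

lemma adjacent_sym: "\<lbrakk>c \<in> C; c' \<in> C\<rbrakk> \<Longrightarrow> adjacent c c' \<longleftrightarrow> adjacent c' c"
  using D_sym[of c c'] C_in_V by (auto simp: adjacent_def)

text \<open>The far points of \<open>{c, c'}\<close> have distance at least
  \<open>2 * (R c + R c') + 1\<close>, which is also the most that the triangle inequality allows,
  so all estimates are tight. The far point in the ball of \<open>c\<close> lies on its boundary and
  points away from \<open>c'\<close>. Such points prolong the chain of centres at its ends.\<close>

lemma adjacent_far_end:
  assumes "c \<in> C" "c' \<in> C" "adjacent c c'"
  shows "\<exists>x\<in>V. D x c = R c \<and> D x c' = R c + D c c'"
proof -
  have cV: "c \<in> V" "c' \<in> V" using assms C_in_V by auto
  obtain d d' v w where *: "d \<in> {c, c'}" "d' \<in> {c, c'}" "d \<noteq> d'" "v \<in> V" "w \<in> V"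
    "D v d \<le> R d" "D w d' \<le> R d'" "2 * sum R {c, c'} < D v w"
    using far_pair[of "{c, c'}"] assms by (auto simp: adjacent_def)
  have sum: "sum R {c, c'} = R c + R c'" "D c' c = D c c'"
    using assms D_sym cV by (auto simp: adjacent_def)
  have tri: "D v w \<le> D v d + D d d' + D d' w" "D v w \<le> D v d' + D d' w" "D v w \<le> D v d + D d w"
      "D d w \<le> D d d' + D d' w" "D v d' \<le> D v d + D d d'" "D d' w = D w d'" "D d w = D w d"
    using D_triangle[of v d w] D_triangle[of d d' w] D_triangle[of v d' w] D_triangle[of v d d']
      D_sym[of d' w] D_sym[of d w] * cV by auto
  show ?thesis
  proof (cases "d = c")
    case True
    then have "d' = c'" using * by auto
    then show ?thesis using True * assms sum tri by (intro bexI[of _ v]) (auto simp: adjacent_def)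
  next
    case False
    then have "d = c'" "d' = c" using * by auto
    then show ?thesis using * assms sum tri by (intro bexI[of _ w]) (auto simp: adjacent_def)
  qed
qed

text \<open>Two far points of \<open>{c, a1, a2, a3}\<close> involve two centres \<open>d\<close>,
  \<open>d'\<close>, joined through \<open>c\<close> by at most two connecting edges. Some member
  \<open>e\<close> of the set is left over, and \<open>2 * R e \<ge> 2\<close> pays for these edges,
  so the points are not far.\<close>

lemma adjacent_degree:
  assumes "c \<in> C" "a1 \<in> C" "a2 \<in> C" "a3 \<in> C" "adjacent c a1" "adjacent c a2" "adjacent c a3"
    and "a1 \<noteq> a2" "a1 \<noteq> a3"
  shows "a2 = a3"
proof (rule ccontr)
  assume neq: "a2 \<noteq> a3"
  define S where "S = {c, a1, a2, a3}"
  have ca: "c \<noteq> a1" "c \<noteq> a2" "c \<noteq> a3" using assms by (auto simp: adjacent_def)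
  have sum: "sum R S = R c + R a1 + R a2 + R a3" "card S = 4"
    using ca neq assms by (auto simp: S_def)
  obtain d d' v w where *: "d \<in> S" "d' \<in> S" "d \<noteq> d'" "v \<in> V" "w \<in> V"
    "D v d \<le> R d" "D w d' \<le> R d'" "2 * sum R S < D v w"
    using far_pair[of S] assms sum by (auto simp: S_def)
  have dV: "d \<in> V" "d' \<in> V" "c \<in> V" using * assms C_in_V by (auto simp: S_def)
  have "D v w \<le> R d + D d d' + R d'" "D d d' \<le> D d c + D c d'" "D d c = D c d"
    using triangle_balls[of d d' v w] D_triangle[of d c d'] D_sym[of d c] * dV by auto
  moreover have "D c b = (if b = c then 0 else R c + R b + 1)" if "b \<in> S" for b
    using that assms dV by (auto simp: S_def adjacent_def)
  then have "D c d = (if d = c then 0 else R c + R d + 1)" "D c d' = (if d' = c then 0 else R c + R d' + 1)"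
    using *(1,2) by auto
  moreover obtain e where e: "e \<in> S" "e \<notin> {c, d, d'}"
  proof -
    have "card {c, d, d'} \<le> 3" using card_length[of "[c, d, d']"] by simp
    then have "\<not> S \<subseteq> {c, d, d'}" using sum card_mono[of "{c, d, d'}" S] by auto
    then show ?thesis using that by blast
  qed
  moreover have "0 < R e" using e assms R_pos by (auto simp: S_def)
  moreover have "sum R {e, c, d, d'} \<le> sum R S"
    using e * by (intro sum_mono2) (auto simp: S_def)
  moreover have "sum R {e, c, d, d'} = R e + R d + R d' + (if d = c \<or> d' = c then 0 else R c)"
  proof (cases "d = c \<or> d' = c")
    case True
    then have "{e, c, d, d'} = {e, d, d'}" by auto
    then show ?thesis using True e \<open>d \<noteq> d'\<close> by simp
  next
    case False
    then have "c \<noteq> d" "c \<noteq> d'" by auto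
    then show ?thesis using e \<open>d \<noteq> d'\<close> by simp
  qed
  ultimately show False using *(3,8) by (simp split: if_splits)
qed

text \<open>The far points of \<open>{c, a1, a2}\<close> must come from \<open>a1\<close> and
  \<open>a2\<close>: for another pair, the positive radius of the third ball makes the bound fail.
  This gives the equation up to one missing unit, which \<open>even_perimeter\<close>
  excludes.\<close>

lemma adjacent_between:
  assumes "c \<in> C" "a1 \<in> C" "a2 \<in> C" "adjacent a1 c" "adjacent c a2" "a1 \<noteq> a2"
  shows "D a1 a2 = D a1 c + D c a2"
proof -
  define S where "S = {c, a1, a2}"
  have ca: "c \<noteq> a1" "c \<noteq> a2" using assms by (auto simp: adjacent_def)
  have V: "a1 \<in> V" "c \<in> V" "a2 \<in> V" using assms C_in_V by auto
  have sum: "sum R S = R c + R a1 + R a2" "card S = 3"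
    using ca assms by (auto simp: S_def)
  obtain d d' v w where *: "d \<in> S" "d' \<in> S" "d \<noteq> d'" "v \<in> V" "w \<in> V"
    "D v d \<le> R d" "D w d' \<le> R d'" "2 * sum R S < D v w"
    using far_pair[of S] assms sum by (auto simp: S_def)
  have dV: "d \<in> V" "d' \<in> V" using * V by (auto simp: S_def)
  have "D v w \<le> R d + D d d' + R d'"
    using triangle_balls[of d d' v w] * dV by auto
  moreover have D: "D c a1 = R c + R a1 + 1" "D a1 c = R c + R a1 + 1" "D c a2 = R c + R a2 + 1"
     "D a2 c = R c + R a2 + 1" "D a2 a1 = D a1 a2"
    using assms V D_sym by (auto simp: adjacent_def)
  moreover have "0 < R a1" "0 < R a2" using assms R_pos by auto
  ultimately have "R a1 + 2 * R c + R a2 + 1 \<le> D a1 a2"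
    using * ca assms sum unfolding S_def by auto
  moreover have "even (D a1 c + D c a2 + D a1 a2)" using even_perimeter V by blast
  moreover have "D a1 a2 \<le> D a1 c + D c a2" using D_triangle V by blast
  ultimately show ?thesis using D by presburger
qed

text \<open>An edge leaving the union of the balls of \<open>Q\<close> ends in the ball of some
  \<open>a\<close> outside \<open>Q\<close>. It gives \<open>D c a \<le> R c + 1 + R a\<close>, and
  \<open>separated\<close> makes this an equality.\<close>

lemma adjacent_connected:
  assumes "Q \<subseteq> C" "Q \<noteq> {}" "Q \<noteq> C"
  shows "\<exists>c\<in>Q. \<exists>a\<in>C - Q. adjacent c a"
proof -
  define U where "U = {v \<in> V. \<exists>c\<in>Q. D v c \<le> R c}"
  obtain q b where q: "q \<in> Q" "b \<in> C - Q" using assms by blast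
  have "q \<in> U" using q assms C_in_V by (auto simp: U_def intro!: bexI[of _ q])
  moreover have "b \<notin> U"
  proof
    assume "b \<in> U"
    then obtain c where "c \<in> Q" "D b c \<le> R c" by (auto simp: U_def)
    then show False using separated[of b c] q assms by fastforce
  qed
  moreover have "U \<subseteq> V" by (auto simp: U_def)
  ultimately obtain x y where xy: "x \<in> U" "y \<in> V - U" "D x y = 1"
    using crossing_edge[of U q b] q C_in_V by blast
  obtain c where c: "c \<in> Q" "D x c \<le> R c" using xy by (auto simp: U_def)
  obtain a where a: "a \<in> C" "D y a \<le> R a" using xy cover by blast
  have aQ: "a \<notin> Q" using a xy by (auto simp: U_def)
  have V: "x \<in> V" "y \<in> V" "c \<in> V" "a \<in> V" using xy a c assms C_in_V by (auto simp: U_def)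
  have "D c a \<le> R c + 1 + R a"
    using D_triangle[of c x a] D_triangle[of x y a] D_sym[of c x] V xy a c by simp
  moreover have "R c + R a < D c a" using separated[of c a] a c aQ assms by blast
  ultimately have "adjacent c a" using c aQ by (auto simp: adjacent_def)
  then show ?thesis using a c aQ by blast
qed

text \<open>A longest chain works. If it missed a centre, \<open>adjacent_connected\<close> would
  attach one to some member: at an end the chain would grow, and an inner member would have three
  neighbours, against \<open>adjacent_degree\<close>.\<close>

lemma ex_adjacent_ordering:
  assumes "C \<noteq> {}"
  shows "\<exists>cs. distinct cs \<and> set cs = C \<and> (\<forall>i. Suc i < length cs \<longrightarrow> adjacent (cs ! i) (cs ! Suc i))"
proof -
  define P where "P cs \<longleftrightarrow> cs \<noteq> [] \<and> distinct cs \<and> set cs \<subseteq> C \<and>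
    (\<forall>i. Suc i < length cs \<longrightarrow> adjacent (cs ! i) (cs ! Suc i))" for cs
  obtain c0 where "c0 \<in> C" using assms by blast
  then have "P [c0]" by (auto simp: P_def)
  moreover have "length cs < Suc (card C)" if "P cs" for cs
    using that finite_C card_mono[of C "set cs"] by (auto simp: P_def distinct_card)
  ultimately obtain cs where cs: "P cs" and max: "\<And>cs'. P cs' \<Longrightarrow> length cs' \<le> length cs"
    using ex_has_greatest_nat[of P "[c0]" length "Suc (card C)"] by blast
  have "set cs = C"
  proof (rule ccontr)
    assume "set cs \<noteq> C"
    then obtain c a where ca: "c \<in> set cs" "a \<in> C" "a \<notin> set cs" "adjacent c a"
      using adjacent_connected[of "set cs"] cs by (auto simp: P_def)
    then obtain i where i: "i < length cs" "cs ! i = c" by (auto simp: in_set_conv_nth)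
    consider "i = 0" | "Suc i = length cs" | j where "i = Suc j" "Suc i < length cs"
      using i by (cases i; cases "Suc i = length cs") auto
    then show False
    proof cases
      case 1
      have "adjacent a c" using ca adjacent_sym[of a c] cs by (auto simp: P_def)
      then have "P (a # cs)" using ca cs i 1 by (auto simp: P_def nth_Cons split: nat.split)
      then show False using max by fastforce
    next
      case 2
      have "adjacent ((cs @ [a]) ! j) ((cs @ [a]) ! Suc j)" if "Suc j < length (cs @ [a])" for j
      proof (cases "Suc j = length cs")
        case True
        then have "j = i" using 2 by simp
        then show ?thesis using ca i True by (simp add: nth_append)
      next
        case False
        then show ?thesis using that cs by (auto simp: P_def nth_append)
      qed
      then have "P (cs @ [a])" using ca cs by (auto simp: P_def)
      then show False using max by fastforce
    next
      case 3
      have *: "cs ! j \<in> C" "cs ! Suc i \<in> C" "c \<in> C" "cs ! j \<in> set cs" "cs ! Suc i \<in> set cs"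
        using cs 3 ca by (auto simp: P_def)
      moreover have "adjacent (cs ! j) c" "adjacent c (cs ! Suc i)"
        using cs 3 i by (auto simp: P_def)
      moreover have "cs ! j \<noteq> cs ! Suc i" using cs 3 by (auto simp: P_def nth_eq_iff_index_eq)
      ultimately show False
        using adjacent_degree[of c a "cs ! j" "cs ! Suc i"] ca adjacent_sym[of c "cs ! j"] by metis
    qed
  qed
  then show ?thesis using cs by (auto simp: P_def)
qed

text \<open>
  In a linear ordering of the centres in which consecutive balls are adjacent, the centres lie on a
  geodesic, which is prolonged in the two extremal balls by a point of the boundary each.
\<close>

lemma spanning_geodesic:
  assumes "2 \<le> card C"
  shows "\<exists>x\<in>V. \<exists>z\<in>V. D x z + 1 = 2 * sum R C + card C \<and>
    (\<forall>c\<in>C. D x c + D c z = D x z \<and> R c \<le> D x c \<and> R c \<le> D c z)"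
proof -
  obtain cs where cs: "distinct cs" "set cs = C"
      and adj: "\<And>i. Suc i < length cs \<Longrightarrow> adjacent (cs ! i) (cs ! Suc i)"
    using ex_adjacent_ordering assms by fastforce
  define k where "k = length cs"
  define y where "y i = cs ! i" for i
  have k: "k = card C" "2 \<le> k" using cs assms distinct_card[OF cs(1)] by (auto simp: k_def)
  define n where "n = k - 1"
  have n: "k = Suc n" "1 \<le> n" using k by (auto simp: n_def)
  have yC: "y i \<in> C" if "i \<le> n" for i using that cs n by (auto simp: y_def k_def)
  have yV: "y i \<in> V" if "i \<le> n" for i using that yC C_in_V by blast
  have inj: "y i = y j \<longleftrightarrow> i = j" if "i \<le> n" "j \<le> n" for i j
    using that cs n by (auto simp: y_def k_def nth_eq_iff_index_eq)
  have adjy: "adjacent (y i) (y (Suc i))" if "i < n" for i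
    using that adj n by (auto simp: y_def k_def)
  have D: "D (y i) (y j) = (\<Sum>l = i..<j. D (y l) (y (Suc l)))" if "i \<le> j" "j \<le> n" for i j
  proof (rule local_geodesic[of n])
    fix i assume "Suc i < n"
    then show "D (y i) (y (Suc (Suc i))) = D (y i) (y (Suc i)) + D (y (Suc i)) (y (Suc (Suc i)))"
      using adjacent_between[of "y (Suc i)" "y i" "y (Suc (Suc i))"] yC adjy inj by simp
  qed (use that yV inj in auto)
  have split: "D (y i) (y l) = D (y i) (y j) + D (y j) (y l)" if "i \<le> j" "j \<le> l" "l \<le> n" for i j l
    using sum.atLeastLessThan_concat[of i j l "\<lambda>l. D (y l) (y (Suc l))"] D[of i j] D[of j l] D[of i l] that
    by linarith
  \<comment> \<open>\<open>x\<close> prolongs the chain beyond \<open>y 0\<close>, and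
    \<open>z\<close> beyond \<open>y n\<close>. Straightness against the neighbouring centre
    suffices, since \<open>between_concat\<close> carries it along the chain.\<close>
  obtain x where x: "x \<in> V" "D x (y 0) = R (y 0)" "D x (y 1) = R (y 0) + D (y 0) (y 1)"
    using adjacent_far_end[of "y 0" "y 1"] adjy[of 0] yC n by auto
  obtain n' where n': "n = Suc n'" using n by (cases n) auto
  obtain z where z: "z \<in> V" "D z (y n) = R (y n)" "D z (y n') = R (y n) + D (y n) (y n')"
    using adjacent_far_end[of "y n" "y n'"] adjy[of n'] yC[of n] yC[of n'] adjacent_sym[of "y n"] n'
    by auto
  have Dx: "D x (y j) = R (y 0) + D (y 0) (y j)" if "j \<le> n" for j
  proof (cases "j = 0")
    case True
    then show ?thesis using x yV[of 0] by simp
  next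
    case False
    then show ?thesis
      using between_concat[of x "y 0" "y 1" "y j"] x that n yV inj[of 0 1] split[of 0 1 j] by simp
  qed
  have Dz: "D (y j) z = D (y j) (y n) + R (y n)" if "j \<le> n" for j
  proof (cases "j = n")
    case True
    then show ?thesis using z yV[of n] D_sym by simp
  next
    case False
    then show ?thesis
      using between_concat[of "y j" "y n'" "y n" z] z that n' yV[of j] yV[of n] yV[of n']
        inj[of n' n] split[of j n' n] D_sym[of z "y n"] D_sym[of z "y n'"] D_sym[of "y n" "y n'"]
      by simp
  qed
  have Dxz: "D x z = R (y 0) + D (y 0) (y n) + R (y n)"
    using between_concat[of x "y 0" "y n" z] x z Dx[of n] Dz[of 0] yV[of 0] yV[of n] inj[of 0 n] n
      D_sym[of z "y n"] by simp
  \<comment> \<open>Vertices are counted instead of edges: each ball contributes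
    \<open>2 * R (y i) + 1\<close> consecutive vertices, whence the \<open>+ 1\<close> on the left
    and \<open>Suc j\<close> on the right.\<close>
  have "R (y 0) + D (y 0) (y j) + R (y j) + 1 = 2 * (\<Sum>i\<le>j. R (y i)) + Suc j" if "j \<le> n" for j
    using that
  proof (induction j)
    case 0
    then show ?case using yV[of 0] by simp
  next
    case (Suc j)
    have "D (y 0) (y (Suc j)) = D (y 0) (y j) + (R (y j) + R (y (Suc j)) + 1)"
      using split[of 0 j "Suc j"] adjy[of j] Suc.prems by (simp add: adjacent_def)
    then show ?case using Suc by simp
  qed
  moreover have "(\<Sum>i\<le>n. R (y i)) = sum R C"
  proof -
    have "bij_betw y {..n} C"
      using bij_betw_nth[of cs "{..<k}" C] cs n by (simp add: y_def[abs_def] k_def lessThan_Suc_atMost)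
    then show ?thesis by (rule sum.reindex_bij_betw)
  qed
  ultimately have len: "D x z + 1 = 2 * sum R C + card C" using Dxz k n by auto
  moreover have "D x c + D c z = D x z \<and> R c \<le> D x c \<and> R c \<le> D c z" if c: "c \<in> C" for c
  proof -
    obtain j where "j < length cs" "cs ! j = c"
      using c cs(2) by (metis in_set_conv_nth)
    then have j: "c = y j" "j \<le> n" using n by (auto simp: y_def k_def)
    have "R (y j) \<le> D x (y j)"
    proof (cases "j = 0")
      case True
      then show ?thesis using x by simp
    next
      case False
      then show ?thesis using Dx[of j] separated[of "y 0" "y j"] yC[of 0] yC[of j] inj[of 0 j] j by simp
    qed
    moreover have "R (y j) \<le> D (y j) z"
    proof (cases "j = n")
      case True
      then show ?thesis using Dz[of n] yV[of n] by simp
    next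
      case False
      then show ?thesis using Dz[of j] separated[of "y j" "y n"] yC[of n] yC[of j] inj[of j n] j by simp
    qed
    ultimately show ?thesis using j Dx Dz Dxz split[of 0 j n] by simp
  qed
  ultimately show ?thesis using x(1) z(1) by blast
qed

text \<open>The path is diametrical because any two points lie in balls around centres at positions
  \<open>m\<close> and \<open>m'\<close>, both balls reach only over positions within
  \<open>0..N\<close>, and hence \<open>R c + D c c' + R c'\<close> never exceeds
  \<open>N\<close>.\<close>

lemma spanning_path:
  assumes "2 \<le> card C"
  shows "\<exists>pos N. (\<forall>n\<le>N. pos n \<in> V) \<and> (\<forall>m n. m \<le> n \<longrightarrow> n \<le> N \<longrightarrow> D (pos m) (pos n) = n - m) \<and>
    N + 1 = 2 * sum R C + card C \<and> (\<forall>c\<in>C. \<exists>m. pos m = c \<and> R c \<le> m \<and> m + R c \<le> N) \<and>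
    (\<forall>v\<in>V. \<forall>w\<in>V. D v w \<le> N)"
proof -
  obtain x z where xz: "x \<in> V" "z \<in> V" "D x z + 1 = 2 * sum R C + card C"
    and on: "\<And>c. c \<in> C \<Longrightarrow> D x c + D c z = D x z \<and> R c \<le> D x c \<and> R c \<le> D c z"
    using spanning_geodesic[OF assms] by blast
  define N where "N = D x z"
  obtain pos where pos: "\<And>n. n \<le> N \<Longrightarrow> pos n \<in> V \<and> D x (pos n) = n \<and> n + D (pos n) z = N"
    and D: "\<And>m n. m \<le> n \<Longrightarrow> n \<le> N \<Longrightarrow> D (pos m) (pos n) = n - m"
    using ex_geodesic_path[OF xz(1,2)] unfolding N_def by metis
  have posC: "pos (D x c) = c" "D x c + R c \<le> N" "R c \<le> D x c" if "c \<in> C" for c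
  proof -
    have *: "D x c + D c z = N" "R c \<le> D x c" "R c \<le> D c z" using on[OF that] by (simp_all add: N_def)
    then show "D x c + R c \<le> N" "R c \<le> D x c" by simp_all
    have "D x c \<le> N" using * by simp
    then show "pos (D x c) = c"
      using between_unique[of x z "pos (D x c)" c] pos[of "D x c"] * xz C_in_V[OF that] by (simp add: N_def)
  qed
  have "D v w \<le> N" if vw: "v \<in> V" "w \<in> V" for v w
  proof -
    obtain c where c: "c \<in> C" "D v c \<le> R c" using cover vw by blast
    obtain c' where c': "c' \<in> C" "D w c' \<le> R c'" using cover vw by blast
    have "D v w \<le> R c + D c c' + R c'"
      using triangle_balls[of c c' v w] vw c c' C_in_V by blast
    moreover have "D c c' \<le> D x c' - D x c \<or> D c c' \<le> D x c - D x c'"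
    proof (cases "D x c \<le> D x c'")
      case True
      then show ?thesis using D[of "D x c" "D x c'"] posC[OF c(1)] posC[OF c'(1)] by simp
    next
      case False
      then show ?thesis using D[of "D x c'" "D x c"] posC[OF c(1)] posC[OF c'(1)] D_sym[of c c']
        C_in_V c c' by simp
    qed
    ultimately show ?thesis using posC(2,3)[OF c(1)] posC(2,3)[OF c'(1)] by linarith
  qed
  then show ?thesis
    using pos D xz(3) posC by (intro exI[of _ pos] exI[of _ N]) (fastforce simp: N_def)
qed

end

section \<open>Merging the balls of a broadcast\<close>

context tree_metric
begin

text \<open>
  A coarsening is encoded by the map \<open>\<phi>\<close> that sends every broadcasting vertex to the centre of the
  ball into which its ball has been merged. One with the least number of centres is incompressible.
\<close>

lemma ex_incompressible_coarsening:
  fixes f :: "'a \<Rightarrow> nat"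
  assumes A: "A \<subseteq> V" "\<And>u. u \<in> A \<Longrightarrow> 0 < f u" and cover: "\<And>v. v \<in> V \<Longrightarrow> \<exists>u\<in>A. D v u \<le> f u"
  shows "\<exists>\<phi> R. R = (\<lambda>c. \<Sum>u | u \<in> A \<and> \<phi> u = c. f u) \<and> incompressible_cover V D (\<phi> ` A) R \<and>
    (\<forall>u\<in>A. \<forall>v\<in>V. D v u \<le> f u \<longrightarrow> D v (\<phi> u) \<le> R (\<phi> u))"
proof -
  have finA: "finite A" using A finite_V finite_subset by blast
  define r where "r \<phi> c = (\<Sum>u | u \<in> A \<and> \<phi> u = c. f u)" for \<phi> :: "'a \<Rightarrow> 'a" and c
  define P where "P \<phi> \<longleftrightarrow> \<phi> ` A \<subseteq> V \<and> (\<forall>u\<in>A. \<forall>v\<in>V. D v u \<le> f u \<longrightarrow> D v (\<phi> u) \<le> r \<phi> (\<phi> u))" for \<phi>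
  have le_r: "f u \<le> r \<phi> (\<phi> u)" if "u \<in> A" for u \<phi>
    unfolding r_def using that finA by (intro member_le_sum) auto
  have "P id" using A(1) le_r[of _ id] le_trans by (fastforce simp: P_def)
  then obtain \<phi> where \<phi>: "P \<phi>" and min: "\<And>\<psi>. P \<psi> \<Longrightarrow> card (\<phi> ` A) \<le> card (\<psi> ` A)"
    using ex_has_least_nat[of P id "\<lambda>\<phi>. card (\<phi> ` A)"] by blast
  have "incompressible_cover V D (\<phi> ` A) (r \<phi>)"
  proof unfold_locales
    show "\<phi> ` A \<subseteq> V" using \<phi> by (simp add: P_def)
    show "0 < r \<phi> c" if "c \<in> \<phi> ` A" for c using that le_r[of _ \<phi>] A(2) by fastforce
    show "\<exists>c\<in>\<phi> ` A. D v c \<le> r \<phi> c" if "v \<in> V" for v using cover[OF that] \<phi> that by (auto simp: P_def)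
    fix S w assume S: "S \<subseteq> \<phi> ` A" "2 \<le> card S" and w: "w \<in> V"
    show "\<exists>c\<in>S. \<exists>v\<in>V. D v c \<le> r \<phi> c \<and> sum (r \<phi>) S < D v w"
    proof (rule ccontr)
      assume "\<not> ?thesis"
      then have small: "\<And>c v. c \<in> S \<Longrightarrow> v \<in> V \<Longrightarrow> D v c \<le> r \<phi> c \<Longrightarrow> D v w \<le> sum (r \<phi>) S"
        by (meson not_le)
      \<comment> \<open>All balls of \<open>S\<close> are redirected to \<open>w\<close>. If
        \<open>w\<close> is already a centre outside \<open>S\<close>, its ball just grows, hence
        inequalities in \<open>rw\<close> and \<open>rc\<close>. At least two centres disappear and
        at most one is new, so their number drops.\<close>
      define \<psi> where "\<psi> u = (if \<phi> u \<in> S then w else \<phi> u)" for u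
      have finS: "finite S" using S finA finite_subset by blast
      have rw: "sum (r \<phi>) S \<le> r \<psi> w"
      proof -
        have "sum (r \<phi>) S = (\<Sum>c\<in>S. \<Sum>u | u \<in> {u \<in> A. \<phi> u \<in> S} \<and> \<phi> u = c. f u)"
          unfolding r_def by (intro sum.cong refl) auto
        also have "\<dots> = sum f {u \<in> A. \<phi> u \<in> S}" using finA finS by (intro sum.group) auto
        also have "\<dots> \<le> r \<psi> w" unfolding r_def using finA by (intro sum_mono2) (auto simp: \<psi>_def)
        finally show ?thesis .
      qed
      have rc: "r \<phi> c \<le> r \<psi> c" if "c \<notin> S" for c
        unfolding r_def using finA that by (intro sum_mono2) (auto simp: \<psi>_def)
      have "P \<psi>"
        unfolding P_def
      proof (intro conjI ballI impI)
        show "\<psi> ` A \<subseteq> V" using \<phi> w by (auto simp: P_def \<psi>_def)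
        fix u v assume "u \<in> A" "v \<in> V" "D v u \<le> f u"
        then have "D v (\<phi> u) \<le> r \<phi> (\<phi> u)" using \<phi> by (simp add: P_def)
        then show "D v (\<psi> u) \<le> r \<psi> (\<psi> u)"
          using small[of "\<phi> u" v] \<open>v \<in> V\<close> rw rc[of "\<phi> u"] by (auto simp: \<psi>_def)
      qed
      moreover have "card (\<psi> ` A) < card (\<phi> ` A)"
      proof -
        have "\<psi> ` A \<subseteq> insert w (\<phi> ` A - S)" by (auto simp: \<psi>_def)
        then have "card (\<psi> ` A) \<le> card (insert w (\<phi> ` A - S))" using finA by (intro card_mono) auto
        also have "\<dots> \<le> Suc (card (\<phi> ` A - S))" by (rule card_insert_le_m1) auto
        also have "card (\<phi> ` A - S) = card (\<phi> ` A) - card S" using S finS by (simp add: card_Diff_subset)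
        also have "Suc (card (\<phi> ` A) - card S) < card (\<phi> ` A)"
          using S card_mono[of "\<phi> ` A" S] finA by simp
        finally show ?thesis .
      qed
      ultimately show False using min by (meson not_le)
    qed
  qed
  then show ?thesis using \<phi> by (intro exI[of _ \<phi>] exI[of _ "r \<phi>"]) (auto simp: P_def r_def[abs_def])
qed

end


section \<open>Distances in undirected trees\<close>

text \<open>With powers of the adjacency relation in place of lists of arcs, splitting and joining
  walks is \<open>relpow_add\<close>, and distances in a component and in the tree compare by
  monotonicity.\<close>

lemma arcs_ends_relpow_awalk:
  assumes "wf_digraph G" "u \<in> verts G"
  shows "(\<exists>p. pre_digraph.awalk G u p v \<and> length p = n) \<longleftrightarrow> (u, v) \<in> arcs_ends G ^^ n"
proof -
  interpret wf_digraph G by fact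
  show ?thesis using \<open>u \<in> verts G\<close>
  proof (induction n arbitrary: u)
    case 0
    then show ?case by (auto simp: awalk_Nil_iff)
  next
    case (Suc n)
    show ?case
    proof
      assume "\<exists>p. awalk u p v \<and> length p = Suc n"
      then obtain a p where p: "awalk u (a # p) v" "length p = n" by (metis length_Suc_conv)
      then have "a \<in> arcs G" "u = tail G a" "awalk (head G a) p v" by (auto simp: awalk_Cons_iff)
      then have "(u, head G a) \<in> arcs_ends G" "(head G a, v) \<in> arcs_ends G ^^ n"
        using Suc.IH[of "head G a"] p by (auto simp: arcs_ends_conv)
      then show "(u, v) \<in> arcs_ends G ^^ Suc n" by (meson relpow_Suc_I2)
    next
      assume "(u, v) \<in> arcs_ends G ^^ Suc n"
      then obtain w where w: "(u, w) \<in> arcs_ends G" "(w, v) \<in> arcs_ends G ^^ n"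
        by (meson relpow_Suc_D2)
      then obtain a where a: "a \<in> arcs G" "tail G a = u" "head G a = w" by (auto simp: arcs_ends_conv)
      obtain p where "awalk w p v" "length p = n"
        using Suc.IH[of w] w a by auto
      then show "\<exists>p. awalk u p v \<and> length p = Suc n"
        using a by (intro exI[of _ "a # p"]) (auto simp: awalk_Cons_iff)
    qed
  qed
qed

lemma gdist_relpow:
  assumes "wf_digraph G" "u \<in> verts G"
  shows "gdist G u v = (LEAST n. (u, v) \<in> arcs_ends G ^^ n)"
  unfolding gdist_def using arcs_ends_relpow_awalk[OF assms] by simp

lemma gdist_le:
  assumes "wf_digraph G" "u \<in> verts G" "(u, v) \<in> arcs_ends G ^^ n"
  shows "gdist G u v \<le> n"
  using assms by (simp add: gdist_relpow Least_le)

lemma gdist_attained: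
  assumes "wf_digraph G" "u \<rightarrow>\<^sup>*\<^bsub>G\<^esub> v"
  shows "(u, v) \<in> arcs_ends G ^^ gdist G u v"
proof -
  interpret wf_digraph G by fact
  have "u \<in> verts G" using reachable_in_verts assms by blast
  moreover obtain n where "(u, v) \<in> arcs_ends G ^^ n"
    using assms reachable_conv rtrancl_power by blast
  ultimately show ?thesis using gdist_relpow[OF assms(1)] LeastI[of "\<lambda>n. (u, v) \<in> arcs_ends G ^^ n"]
    by simp
qed

lemma wf_digraph_del_edges: "wf_digraph G \<Longrightarrow> wf_digraph (del_edges G M)"
  by (auto simp: del_edges_def wf_digraph_def)

lemma arcs_ends_del_edges: "arcs_ends (del_edges G M) = {(u, v) \<in> arcs_ends G. {u, v} \<notin> M}"
  by (auto simp: del_edges_def arcs_ends_conv)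

lemma subgraph_del_edges: "wf_digraph G \<Longrightarrow> subgraph (del_edges G M) G"
  using wf_digraph_del_edges[of G M] by (auto simp: subgraph_def compatible_def del_edges_def)

locale utree = graph +
  assumes reach: "\<lbrakk>u \<in> verts G; v \<in> verts G\<rbrakk> \<Longrightarrow> u \<rightarrow>\<^sup>* v"
    and no_cycle: "cycle p \<Longrightarrow> length p < 3"

lemma undirected_tree_utree:
  assumes "undirected_tree G"
  shows "utree G"
proof -
  have G: "graph G" "Digraph_Component.connected G" "\<not> (\<exists>p. pre_digraph.cycle G p \<and> 3 \<le> length p)"
    using assms by (simp_all add: undirected_tree_def)
  interpret graph G by (rule G)
  have "strongly_connected G"
    using symmetric_connected_imp_strongly_connected sym_arcs G(2) by blast
  then have "\<And>u v. \<lbrakk>u \<in> verts G; v \<in> verts G\<rbrakk> \<Longrightarrow> u \<rightarrow>\<^sup>*\<^bsub>G\<^esub> v" by (simp add: strongly_connected_def)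
  moreover have "\<And>p. cycle p \<Longrightarrow> length p < 3" using G(3) by (meson not_le)
  ultimately show ?thesis by (intro utree.intro utree_axioms.intro G(1))
qed

context utree
begin

abbreviation "D \<equiv> gdist G"

lemma arcs_ends_sym: "u \<rightarrow> v \<Longrightarrow> v \<rightarrow> u"
  by (rule arcs_ends_symmetric[OF sym_arcs])

lemma relpow_D: "\<lbrakk>u \<in> verts G; v \<in> verts G\<rbrakk> \<Longrightarrow> (u, v) \<in> arcs_ends G ^^ D u v"
  by (rule gdist_attained[OF wf_digraph reach])

lemma D_le: "\<lbrakk>u \<in> verts G; (u, v) \<in> arcs_ends G ^^ n\<rbrakk> \<Longrightarrow> D u v \<le> n"
  by (rule gdist_le[OF wf_digraph])

lemma relpow_in_verts: "\<lbrakk>(u, v) \<in> arcs_ends G ^^ n; u \<in> verts G\<rbrakk> \<Longrightarrow> v \<in> verts G"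
  by (cases n) (auto dest: adj_in_verts(2))

lemma D_tri:
  assumes "u \<in> verts G" "v \<in> verts G" "w \<in> verts G"
  shows "D u w \<le> D u v + D v w"
  using assms relpow_D[of u v] relpow_D[of v w] by (intro D_le) (simp_all add: relpow_add relcompI)

lemma D_zero: "\<lbrakk>u \<in> verts G; v \<in> verts G\<rbrakk> \<Longrightarrow> D u v = 0 \<longleftrightarrow> u = v"
  using relpow_D[of u v] D_le[of u v 0] by auto

lemma D_commute:
  assumes "u \<in> verts G" "v \<in> verts G"
  shows "D u v = D v u"
proof -
  have "(v, u) \<in> arcs_ends G ^^ n" if "(u, v) \<in> arcs_ends G ^^ n" for u v n
    using that
  proof (induction n arbitrary: v)
    case (Suc n)
    then obtain w where "(u, w) \<in> arcs_ends G ^^ n" "w \<rightarrow> v" by auto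
    then show ?case using relpow_Suc_I2[OF arcs_ends_sym Suc.IH] by blast
  qed auto
  then show ?thesis
    using D_le[of u v] D_le[of v u] relpow_D[of u v] relpow_D[of v u] assms by (simp add: le_antisym)
qed

lemma D_geodesic:
  assumes "u \<in> verts G" "v \<in> verts G" "k \<le> D u v"
  shows "\<exists>z\<in>verts G. D u z = k \<and> D u z + D z v = D u v"
proof -
  have "(u, v) \<in> arcs_ends G ^^ (k + (D u v - k))" using relpow_D assms by simp
  then obtain z where z: "(u, z) \<in> arcs_ends G ^^ k" "(z, v) \<in> arcs_ends G ^^ (D u v - k)"
    unfolding relpow_add by blast
  then have "z \<in> verts G" using relpow_in_verts assms by blast
  then show ?thesis
    using D_le[OF _ z(1)] D_le[OF _ z(2)] D_tri[of u z v] assms by (intro bexI[of _ z]) auto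
qed

lemma adj_iff: "u \<in> verts G \<Longrightarrow> v \<in> verts G \<Longrightarrow> u \<rightarrow> v \<longleftrightarrow> D u v = 1"
proof
  assume "u \<in> verts G" "v \<in> verts G" "u \<rightarrow> v"
  then show "D u v = 1" using D_le[of u v 1] D_zero[of u v] adj_not_same by fastforce
next
  assume "u \<in> verts G" "v \<in> verts G" "D u v = 1"
  then show "u \<rightarrow> v" using relpow_D[of u v] by simp
qed

text \<open>The only walk with one arc from \<open>y\<close> to \<open>x\<close> uses the deleted
  edge, so a path avoiding it has at least two arcs and is closed by the edge to a cycle of length
  at least 3.\<close>

lemma no_detour:
  assumes "x \<rightarrow> y" "(y, x) \<in> (arcs_ends G - {(x, y), (y, x)})\<^sup>*"
  shows False
proof -
  define H where "H = del_edges G {{x, y}}"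
  interpret H: wf_digraph H using wf_digraph_del_edges wf_digraph by (auto simp: H_def)
  have "arcs_ends H = arcs_ends G - {(x, y), (y, x)}"
    by (auto simp: H_def arcs_ends_del_edges doubleton_eq_iff)
  moreover have "y \<in> verts H" using assms adj_in_verts by (auto simp: H_def del_edges_def)
  ultimately have "y \<rightarrow>\<^sup>*\<^bsub>H\<^esub> x" using assms H.reachable_conv' by simp
  then obtain p where p: "H.apath y p x" using H.reachable_apath by blast
  then have Gp: "apath y p x"
    using subgraph_apath_imp_apath subgraph_del_edges[OF wf_digraph] by (auto simp: H_def)
  obtain a where a: "a \<in> arcs G" "tail G a = x" "head G a = y" using assms by auto
  have "x \<noteq> y" using assms adj_not_same by blast
  have "cycle (a # p)"
    using Gp a by (auto simp: cycle_def apath_def awalk_Cons_iff intro!: exI[of _ x])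
  moreover have "2 \<le> length p"
  proof (cases p rule: vwalk_arcs.cases)
    case 1
    then show ?thesis using p \<open>x \<noteq> y\<close> by (auto simp: H.apath_Nil_iff)
  next
    case (2 b)
    then have "b \<in> arcs H" "tail H b = y" "head H b = x"
      using p by (auto simp: H.apath_def H.awalk_Cons_iff H.awalk_Nil_iff)
    then show ?thesis by (simp add: H_def del_edges_def insert_commute)
  qed auto
  ultimately show False using no_cycle[of "a # p"] by simp
qed

text \<open>The edge separates \<open>y\<close> from \<open>z\<close>. Otherwise geodesics from
  \<open>x'\<close> to \<open>y\<close>, from \<open>y\<close> to \<open>z\<close> and from
  \<open>z\<close> to \<open>x\<close> would all avoid it and form a detour. The weak inequality for
  \<open>z\<close> is deliberate: its equality case yields \<open>D_bipartite\<close>.\<close>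

lemma bridge:
  assumes xy: "x \<rightarrow> x'" and V: "y \<in> verts G" "z \<in> verts G"
    and toy: "D x' y < D x y" and toz: "D x z \<le> D x' z"
  shows "D y z = D y x + D x z"
proof (rule ccontr)
  assume neq: "D y z \<noteq> D y x + D x z"
  define R where "R = arcs_ends G - {(x, x'), (x', x)}"
  have xV: "x \<in> verts G" "x' \<in> verts G" using xy adj_in_verts by auto
  have step: "\<exists>w. u \<rightarrow> w \<and> w \<in> verts G \<and> Suc (D w v) = D u v"
    if uv: "u \<in> verts G" "v \<in> verts G" "u \<noteq> v" for u v
  proof -
    have "1 \<le> D u v" using D_zero[of u v] that by auto
    then obtain w where "w \<in> verts G" "D u w = 1" "D u w + D w v = D u v"
      using D_geodesic[of u v 1] uv by blast
    then show ?thesis using adj_iff[of u w] uv by (intro exI[of _ w]) simp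
  qed
  have y: "(u, y) \<in> R\<^sup>*" if "u \<in> verts G" "D u y < D x y" for u
    using that
  proof (induction "D u y" arbitrary: u rule: less_induct)
    case less
    show ?case
    proof (cases "u = y")
      case False
      then obtain w where w: "u \<rightarrow> w" "w \<in> verts G" "Suc (D w y) = D u y"
        using step[of u] less.prems V by blast
      then have "(u, w) \<in> R" using less.prems by (auto simp: R_def)
      moreover have "(w, y) \<in> R\<^sup>*" using less.hyps[of w] less.prems w by simp
      ultimately show ?thesis by (rule converse_rtrancl_into_rtrancl)
    qed simp
  qed
  have z: "(u, z) \<in> R\<^sup>*" if "u \<in> verts G" "D u z \<le> D x z" for u
    using that
  proof (induction "D u z" arbitrary: u rule: less_induct)
    case less
    show ?case
    proof (cases "u = z")
      case False
      then obtain w where w: "u \<rightarrow> w" "w \<in> verts G" "Suc (D w z) = D u z"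
        using step[of u] less.prems V by blast
      then have "(u, w) \<in> R" using less.prems toz by (auto simp: R_def)
      moreover have "(w, z) \<in> R\<^sup>*" using less.hyps[of w] less.prems w by simp
      ultimately show ?thesis by (rule converse_rtrancl_into_rtrancl)
    qed simp
  qed
  have yz: "(u, z) \<in> R\<^sup>*" if "u \<in> verts G" "D y u + D u z = D y z" for u
    using that
  proof (induction "D u z" arbitrary: u rule: less_induct)
    case less
    show ?case
    proof (cases "u = z")
      case False
      then obtain w where w: "u \<rightarrow> w" "w \<in> verts G" "Suc (D w z) = D u z"
        using step[of u] less.prems V by blast
      then have wy: "D y w = Suc (D y u)" "D y w + D w z = D y z"
        using D_tri[of y u w] D_tri[of y w z] less.prems V adj_iff[of u w] by auto
      \<comment> \<open>Along the geodesic the distance from \<open>y\<close> grows, whereas it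
        falls from \<open>x\<close> to \<open>x'\<close>. Arriving at \<open>x\<close> would put
        \<open>x\<close> on the geodesic, against \<open>neq\<close>.\<close>
      then have "(u, w) \<noteq> (x, x')" using toy D_commute[of y x] D_commute[of y x'] xV V by auto
      moreover have "(u, w) \<noteq> (x', x)" using wy neq by auto
      ultimately have "(u, w) \<in> R" using w by (simp add: R_def)
      moreover have "(w, z) \<in> R\<^sup>*" using less.hyps[of w] w wy by simp
      ultimately show ?thesis by (rule converse_rtrancl_into_rtrancl)
    qed simp
  qed
  have "sym R" unfolding R_def sym_def using arcs_ends_sym by blast
  then have "sym (R\<^sup>*)" by (rule sym_rtrancl)
  then have "(z, x) \<in> R\<^sup>*" using z[of x] xV by (auto dest: symD)
  moreover have "(x', y) \<in> R\<^sup>*" using y[of x'] xV toy by simp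
  moreover have "(y, z) \<in> R\<^sup>*" using yz[of y] V D_zero by simp
  ultimately have "(x', x) \<in> R\<^sup>*" by (meson rtrancl_trans)
  then show False using no_detour[OF xy] by (simp add: R_def)
qed

lemma D_bipartite:
  assumes "x \<in> verts G" "y \<in> verts G" "z \<in> verts G" "D x y = 1"
  shows "D x z \<noteq> D y z"
proof
  assume eq: "D x z = D y z"
  have "x \<rightarrow> y" using assms adj_iff by blast
  moreover have "D y y = 0" using assms D_zero by blast
  moreover have "D y x = 1" using assms D_commute by metis
  ultimately show False using bridge[of x y y z] assms eq by simp
qed

text \<open>Let \<open>x'\<close> be the next vertex towards \<open>y\<close>. If \<open>z\<close>
  or \<open>w\<close> is not closer to \<open>x'\<close>, then by \<open>bridge\<close>
  \<open>x\<close> lies between it and \<open>y\<close>, and the triangle inequality suffices.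
  Otherwise passing from \<open>x'\<close> back to \<open>x\<close> raises both sides by
  one.\<close>

lemma D_four_point:
  assumes "x \<in> verts G" "y \<in> verts G" "z \<in> verts G" "w \<in> verts G"
  shows "D x y + D z w \<le> max (D x z + D y w) (D x w + D y z)"
  using assms
proof (induction "D x y" arbitrary: x)
  case 0
  then have "x = y" using D_zero by auto
  then show ?case using 0 D_tri[of z x w] D_commute[of z x] D_zero[of x x] by simp
next
  case (Suc n)
  obtain x' where x': "x' \<in> verts G" "D x x' = 1" "D x x' + D x' y = D x y"
    using D_geodesic[of x y 1] Suc.hyps(2) Suc.prems by auto
  have adj: "x \<rightarrow> x'" using x' adj_iff Suc.prems by blast
  have between: "D y a = D y x + D x a" if "a \<in> verts G" "D x a \<le> D x' a" for a
    using bridge[OF adj, of y a] that x' Suc.prems by simp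
  have tri: "D z w \<le> D x z + D x w" "D y x = D x y"
    using D_tri[of z x w] D_commute[of z x] D_commute[of y x] Suc.prems by auto
  have far: "D x y + D z w \<le> max (D x z + D y w) (D x w + D y z)"
    if "D x z \<le> D x' z \<or> D x w \<le> D x' w"
    using that
  proof
    assume "D x z \<le> D x' z"
    then show ?thesis using between[of z] tri Suc.prems by simp
  next
    assume "D x w \<le> D x' w"
    then show ?thesis using between[of w] tri Suc.prems by simp
  qed
  show ?case
  proof (cases "D x z \<le> D x' z \<or> D x w \<le> D x' w")
    case True
    then show ?thesis using far by blast
  next
    case False
    then have "D x z = Suc (D x' z)" "D x w = Suc (D x' w)"
      using D_tri[of x x' z] D_tri[of x x' w] x'(1,2) Suc.prems by auto
    moreover have "D x' y + D z w \<le> max (D x' z + D y w) (D x' w + D y z)"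
      using Suc.hyps(1)[of x'] Suc.hyps(2) Suc.prems x' by simp
    ultimately show ?thesis using x'(2,3) by simp
  qed
qed

sublocale tree_metric "verts G" D
  by unfold_locales
    (fact finite_verts D_zero D_commute D_tri D_geodesic D_four_point D_bipartite)+

end

lemma relpow_subset:
  fixes R S :: "'a rel"
  shows "(u, v) \<in> R ^^ n \<Longrightarrow> R \<subseteq> S \<Longrightarrow> (u, v) \<in> S ^^ n"
proof (induction n arbitrary: v)
  case (Suc n)
  then obtain w where "(u, w) \<in> R ^^ n" "(w, v) \<in> R" by auto
  then have "(u, w) \<in> S ^^ n" "(w, v) \<in> S" using Suc by auto
  then show ?case by (rule relpow_Suc_I)
qed simp

lemma set_vwalk_arcs_nth: "set (vwalk_arcs p) = {(p ! i, p ! Suc i) |i. Suc i < length p}"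
proof -
  have "vwalk_arcs p = zip p (tl p)" by (induction p rule: vwalk_arcs.induct) auto
  then show ?thesis by (force simp: set_zip nth_tl)
qed

section \<open>Eccentricity, diameter and radius of finite graphs; components after deleting
  edges\<close>

context
  fixes G :: "('a, 'b) pre_digraph"
  assumes fin: "finite (verts G)"
begin

lemma gdist_le_ecc: "w \<in> verts G \<Longrightarrow> gdist G v w \<le> ecc G v"
  unfolding ecc_def using fin by (intro Max_ge) auto

lemma ecc_le: "v \<in> verts G \<Longrightarrow> (\<And>w. w \<in> verts G \<Longrightarrow> gdist G v w \<le> n) \<Longrightarrow> ecc G v \<le> n"
  unfolding ecc_def using fin by (subst Max_le_iff) auto

lemma ecc_le_diam: "v \<in> verts G \<Longrightarrow> ecc G v \<le> diam G"
  unfolding diam_def using fin by (intro Max_ge) auto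

lemma gdist_le_diam: "v \<in> verts G \<Longrightarrow> w \<in> verts G \<Longrightarrow> gdist G v w \<le> diam G"
  using gdist_le_ecc ecc_le_diam le_trans by blast

lemma diam_le:
  assumes "verts G \<noteq> {}" "\<And>v w. \<lbrakk>v \<in> verts G; w \<in> verts G\<rbrakk> \<Longrightarrow> gdist G v w \<le> n"
  shows "diam G \<le> n"
  unfolding diam_def using fin assms by (subst Max_le_iff) (auto intro: ecc_le)

lemma rad_le_ecc: "v \<in> verts G \<Longrightarrow> rad G \<le> ecc G v"
  unfolding rad_def using fin by (intro Min_le) auto

lemma ex_rad:
  assumes "verts G \<noteq> {}"
  shows "\<exists>v\<in>verts G. ecc G v = rad G"
proof -
  have "rad G \<in> ecc G ` verts G" unfolding rad_def using fin assms by (intro Min_in) auto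
  then show ?thesis by auto
qed

end

context utree
begin

lemma component_facts:
  assumes "H \<in> components (del_edges G M)"
  shows "wf_digraph H" "verts H \<subseteq> verts G" "verts H \<noteq> {}"
    and "arcs_ends H = {(u, v). u \<rightarrow> v \<and> {u, v} \<notin> M \<and> u \<in> verts H \<and> v \<in> verts H}"
    and "\<And>u v. \<lbrakk>u \<in> verts H; v \<in> verts H\<rbrakk> \<Longrightarrow> u \<rightarrow>\<^sup>*\<^bsub>H\<^esub> v"
proof -
  have H: "induced_subgraph H (del_edges G M)" "strongly_connected H"
    using assms by (auto simp: pre_digraph.sccs_def)
  then show wf: "wf_digraph H" and "verts H \<noteq> {}"
      and "\<And>u v. \<lbrakk>u \<in> verts H; v \<in> verts H\<rbrakk> \<Longrightarrow> u \<rightarrow>\<^sup>*\<^bsub>H\<^esub> v"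
    by (auto simp: induced_subgraph_def subgraph_def strongly_connected_def)
  show "verts H \<subseteq> verts G"
    using H(1) by (auto simp: induced_subgraph_def subgraph_def del_edges_def)
  show "arcs_ends H = {(u, v). u \<rightarrow> v \<and> {u, v} \<notin> M \<and> u \<in> verts H \<and> v \<in> verts H}"
    using H(1)
    by (auto simp: induced_subgraph_def subgraph_def compatible_def del_edges_def arcs_ends_conv)
qed

lemma finite_component: "H \<in> components (del_edges G M) \<Longrightarrow> finite (verts H)"
  using component_facts(2) finite_subset finite_verts by metis

text \<open>A walk in \<open>H\<close> reduces to the geodesic of the tree by cancelling backtracks:
  if a new edge leads closer to \<open>u\<close>, then by \<open>between_unique\<close> it undoes
  the last step of the geodesic built so far, and that step is dropped.\<close>

lemma component_relpow:
  assumes H: "H \<in> components (del_edges G M)" and "u \<in> verts H" "v \<in> verts H"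
  shows "(u, v) \<in> arcs_ends H ^^ D u v"
proof -
  note facts = component_facts[OF H]
  interpret H: wf_digraph H by (rule facts(1))
  have V: "w \<in> verts G" if "w \<in> verts H" for w using that facts(2) by blast
  have sub: "arcs_ends H \<subseteq> arcs_ends G" unfolding facts(4) by auto
  have "u \<rightarrow>\<^sup>*\<^bsub>H\<^esub> v" using facts(5) assms by blast
  then show ?thesis
  proof (induction rule: H.reachable_induct)
    case base
    then show ?case using V by simp
  next
    case (step x y)
    have xy: "x \<in> verts H" "y \<in> verts H" "x \<rightarrow> y" using step facts(4) by auto
    have uV: "u \<in> verts G" "x \<in> verts G" "y \<in> verts G" using V assms xy by auto
    have D1: "D x y = 1" "D y x = 1" using adj_iff xy uV D_sym[of y x] by auto
    have "D u x \<noteq> D u y" using D_bipartite[of x y u] D_sym[of u x] D_sym[of u y] D1 uV by simp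
    moreover have "D u y \<le> D u x + 1" "D u x \<le> D u y + 1"
      using D_triangle[of u x y] D_triangle[of u y x] D1 uV by auto
    ultimately consider "D u y = Suc (D u x)" | "D u x = Suc (D u y)" by linarith
    then show ?case
    proof cases
      case 1
      then show ?thesis using step by auto
    next
      case 2
      then obtain w where w: "(u, w) \<in> arcs_ends H ^^ D u y" "(w, x) \<in> arcs_ends H"
        using step by auto
      then have "w \<in> verts G" using V H.adj_in_verts by blast
      moreover have "D w x = 1" using w(2) sub adj_iff uV \<open>w \<in> verts G\<close> by blast
      moreover have "D u w \<le> D u y"
        using D_le relpow_subset[OF w(1) sub] uV(1) by blast
      ultimately have "w = y"
        using between_unique[of u x w y] D_triangle[of u w x] D1 2 uV by simp
      then show ?thesis using w by simp
    qed
  qed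
qed

lemma component_gdist:
  assumes H: "H \<in> components (del_edges G M)" and "u \<in> verts H" "v \<in> verts H"
  shows "gdist H u v = D u v"
proof (rule le_antisym)
  note facts = component_facts[OF H]
  show "gdist H u v \<le> D u v"
    using gdist_le[OF facts(1)] component_relpow[OF assms] assms by blast
  have "(u, v) \<in> arcs_ends H ^^ gdist H u v"
    using gdist_attained[OF facts(1)] facts(5) assms by blast
  moreover have "arcs_ends H \<subseteq> arcs_ends G" unfolding facts(4) by auto
  ultimately have "(u, v) \<in> arcs_ends G ^^ gdist H u v" using relpow_subset by metis
  then show "D u v \<le> gdist H u v" using D_le facts(2) assms by blast
qed

lemma component_edge:
  assumes H: "H \<in> components (del_edges G M)" and "u \<in> verts H" "v \<in> verts H" "u \<rightarrow> v"
  shows "(u, v) \<in> arcs_ends H" "{u, v} \<notin> M"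
proof -
  have "D u v = 1" using adj_iff component_facts(2)[OF H] assms by blast
  then show "(u, v) \<in> arcs_ends H" using component_relpow[OF assms(1-3)] by simp
  then show "{u, v} \<notin> M" by (simp add: component_facts(4)[OF H])
qed

text \<open>The vertex at distance \<open>D u w\<close> on a geodesic inside \<open>H\<close> is
  \<open>w\<close> itself, by \<open>between_unique\<close>.\<close>

lemma component_convex:
  assumes H: "H \<in> components (del_edges G M)" and "u \<in> verts H" "v \<in> verts H" "w \<in> verts G"
    and "D u w + D w v = D u v"
  shows "w \<in> verts H"
proof -
  note facts = component_facts[OF H]
  interpret H: wf_digraph H by (rule facts(1))
  have V: "w \<in> verts G" if "w \<in> verts H" for w using that facts(2) by blast
  have "arcs_ends H \<subseteq> arcs_ends G" unfolding facts(4) by auto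
  then have le: "D a b \<le> n" if "(a, b) \<in> arcs_ends H ^^ n" "a \<in> verts G" for a b n
    using that D_le relpow_subset by metis
  have "(u, v) \<in> arcs_ends H ^^ (D u w + D w v)" using component_relpow[OF assms(1-3)] assms by simp
  then obtain z where z: "(u, z) \<in> arcs_ends H ^^ D u w" "(z, v) \<in> arcs_ends H ^^ D w v"
    unfolding relpow_add by blast
  have zH: "z \<in> verts H"
    using z(1) assms(2) H.adj_in_verts(2) by (cases "D u w") auto
  then have "D u z \<le> D u w" "D z v \<le> D w v" using le z V assms by auto
  then have "z = w"
    using between_unique[of u v z w] D_triangle[of u z v] V assms zH by simp
  then show ?thesis using zH by simp
qed

lemma component_cover:
  assumes "v \<in> verts G"
  shows "\<exists>H\<in>components (del_edges G M). v \<in> verts H"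
proof -
  interpret F: wf_digraph "del_edges G M" using wf_digraph_del_edges wf_digraph by blast
  have "v \<in> verts (del_edges G M)" using assms by (simp add: del_edges_def)
  then have "F.scc_of v \<in> F.sccs_verts" "v \<in> F.scc_of v"
    by (auto intro: F.scc_of_in_sccs_verts F.in_scc_of_self)
  then show ?thesis using F.sccs_verts_conv by auto
qed

lemma component_unique:
  assumes "H \<in> components (del_edges G M)" "H' \<in> components (del_edges G M)"
    and "v \<in> verts H" "v \<in> verts H'"
  shows "H = H'"
proof -
  interpret F: wf_digraph "del_edges G M" using wf_digraph_del_edges wf_digraph by blast
  have "verts H \<in> F.sccs_verts" "verts H' \<in> F.sccs_verts" using assms F.sccs_verts_conv by auto
  then have eq: "verts H = verts H'" using F.sccs_verts_disjoint assms by blast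
  have "induced_subgraph H (del_edges G M)" "induced_subgraph H' (del_edges G M)"
    using assms by (auto simp: F.sccs_def)
  then show ?thesis using F.induce_eq_iff_induced eq by metis
qed

lemma finite_components: "finite (components (del_edges G M))"
proof (rule inj_on_finite[of verts _ "Pow (verts G)"])
  show "inj_on verts (components (del_edges G M))"
  proof (rule inj_onI)
    fix H H' assume *: "H \<in> components (del_edges G M)" "H' \<in> components (del_edges G M)" "verts H = verts H'"
    then obtain v where "v \<in> verts H" using component_facts(3) by blast
    then show "H = H'" using component_unique * by metis
  qed
  show "verts ` components (del_edges G M) \<subseteq> Pow (verts G)" using component_facts(2) by blast
qed simp

end

section \<open>Covers and split-sets\<close>

context utree
begin

lemma ecc_pos:
  assumes "2 \<le> card (verts G)" "v \<in> verts G"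
  shows "0 < ecc G v"
proof -
  have "\<not> verts G \<subseteq> {v}" using assms card_mono[of "{v}" "verts G"] by auto
  then obtain w where "w \<in> verts G" "w \<noteq> v" by blast
  then show ?thesis using gdist_le_ecc[OF finite_verts, of w v] D_eq_0[of v w] assms by fastforce
qed

text \<open>Balls of the family may share centres or have radii beyond the eccentricity. Adding up
  the radii at each centre and capping at the eccentricity gives a legal broadcast that still
  dominates and costs no more.\<close>

lemma gamma_b_le_cover:
  assumes "finite K" "2 \<le> card (verts G)"
    and cen: "\<And>k. k \<in> K \<Longrightarrow> cen k \<in> verts G \<and> 0 < \<rho> k"
    and cover: "\<And>v. v \<in> verts G \<Longrightarrow> \<exists>k\<in>K. D v (cen k) \<le> \<rho> k"
  shows "gamma_b G \<le> sum \<rho> K"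
proof -
  define g where "g v = (if v \<in> verts G then min (ecc G v) (\<Sum>k | k \<in> K \<and> cen k = v. \<rho> k) else 0)" for v
  have "broadcast G g"
    using assms ecc_le_diam[OF finite_verts] by (auto simp: broadcast_def g_def min_le_iff_disj)
  moreover have "dominating G g"
    unfolding dominating_def
  proof
    fix u assume u: "u \<in> verts G"
    obtain k where k: "k \<in> K" "D u (cen k) \<le> \<rho> k" using cover u by blast
    have kV: "cen k \<in> verts G" "0 < \<rho> k" using cen k by auto
    have "\<rho> k \<le> (\<Sum>l | l \<in> K \<and> cen l = cen k. \<rho> l)"
      using k assms by (intro member_le_sum) auto
    moreover have "D u (cen k) \<le> ecc G (cen k)"
      using gdist_le_ecc[OF finite_verts] D_sym[of u "cen k"] u kV by simp
    moreover have "0 < ecc G (cen k)" using ecc_pos assms kV by blast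
    ultimately have "hears_from G g u (cen k)"
      using k kV by (simp add: hears_from_def broadcasting_def g_def)
    then show "\<exists>v. hears_from G g u v" ..
  qed
  ultimately have "gamma_b G \<le> cost G g" unfolding gamma_b_def by (intro Least_le) blast
  also have "\<dots> \<le> (\<Sum>v\<in>verts G. \<Sum>k | k \<in> K \<and> cen k = v. \<rho> k)"
    unfolding cost_def by (intro sum_mono) (simp add: g_def)
  also have "\<dots> = sum \<rho> K" using assms cen by (intro sum.group) auto
  finally show ?thesis .
qed

lemma split_set_bound:
  assumes "split_set G M"
  shows "2 * gamma_b G + card M \<le> diam G" "2 \<le> card (verts G)"
proof -
  define K where "K = components (del_edges G M)"
  obtain p where p: "vpath p G" "length p - 1 = D (hd p) (last p)" "D (hd p) (last p) = diam G"
      and M: "M \<subseteq> path_edges p" "1 \<le> card M"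
      and K: "\<And>H. H \<in> K \<Longrightarrow> even (vwalk_length (subpath_in p H)) \<and> 0 < vwalk_length (subpath_in p H) \<and>
        diametrical_path H (subpath_in p H)"
    using assms by (auto simp: split_set_def split_set_on_def diametrical_path_def K_def)
  have p': "p \<noteq> []" "distinct p" "set p \<subseteq> verts G" using p by (auto simp: vpath_def vwalk_def)
  have adj: "p ! i \<rightarrow> p ! Suc i" if "Suc i < length p" for i
    using p(1) that by (auto simp: vpath_def vwalk_def set_vwalk_arcs_nth)
  have V: "p ! i \<in> verts G" if "i < length p" for i using p' that nth_mem by blast
  have le: "D (p ! i) (p ! j) \<le> j - i" if "i \<le> j" "j < length p" for i j
    using that
  proof (induction j rule: dec_induct)
    case base
    then show ?case using V by simp
  next
    case (step j)
    then show ?case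
      using D_triangle[of "p ! i" "p ! j" "p ! Suc j"] V[of i] V[of j] V[of "Suc j"] adj[of j]
        adj_iff[of "p ! j" "p ! Suc j"] by simp
  qed
  define n where "n = length p - 1"
  have "length p = Suc n" using p'(1) by (cases p) (simp_all add: n_def)
  moreover have "D (p ! 0) (p ! n) = n" "n = diam G"
    using p p' by (auto simp: n_def hd_conv_nth last_conv_nth)
  ultimately have n: "length p = Suc n" "D (p ! 0) (p ! n) = n" "n = diam G" by simp_all
  \<comment> \<open>A shortcut between \<open>p ! i\<close> and \<open>p ! j\<close> would shorten
    the distance of the two ends of \<open>p\<close>, which is \<open>n\<close>.\<close>
  have D: "D (p ! i) (p ! j) = j - i" if "i \<le> j" "j < length p" for i j
  proof -
    have "n \<le> i + (D (p ! i) (p ! j) + (n - j))"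
      using D_triangle[of "p ! 0" "p ! i" "p ! n"] D_triangle[of "p ! i" "p ! j" "p ! n"]
        le[of 0 i] le[of j n] that n V[of 0] V[of i] V[of j] V[of n] by simp
    then show ?thesis using le[OF that] that n by simp
  qed
  \<comment> \<open>\<open>S H\<close> holds the positions of the vertices of \<open>p\<close> in
    \<open>H\<close>, \<open>I H\<close> those of the edges of \<open>p\<close> inside
    \<open>H\<close>, and \<open>J\<close> those of the edges in \<open>M\<close>; an edge is
    located by its first vertex.\<close>
  define S where "S H = {i. i < length p \<and> p ! i \<in> verts H}" for H :: "('a, 'b) pre_digraph"
  define I where "I H = {i. Suc i < length p \<and> p ! i \<in> verts H \<and> p ! Suc i \<in> verts H}"
    for H :: "('a, 'b) pre_digraph"
  define J where "J = {i. Suc i < length p \<and> {p ! i, p ! Suc i} \<in> M}"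
  have len: "vwalk_length (subpath_in p H) = card (S H) - 1" for H
    by (simp add: subpath_in_def length_filter_conv_card S_def)
  \<comment> \<open>By convexity of \<open>H\<close>, each position in \<open>S H\<close> except the
    last one starts an edge inside \<open>H\<close>.\<close>
  have SI: "card (S H) - 1 \<le> card (I H)" if H: "H \<in> K" for H
  proof -
    have "0 < card (S H)" using K[OF H] unfolding len by linarith
    then have fS: "finite (S H)" "S H \<noteq> {}" by (auto simp: card_gt_0_iff)
    have "S H - {Max (S H)} \<subseteq> I H"
    proof
      fix i assume i: "i \<in> S H - {Max (S H)}"
      define j where "j = Max (S H)"
      have "i \<le> j" "i \<noteq> j" using i Max_ge[OF fS(1), of i] by (auto simp: j_def)
      then have j: "j \<in> S H" "i < j" using Max_in[OF fS] by (simp_all add: j_def)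
      then have "p ! Suc i \<in> verts H"
        using component_convex[OF H[unfolded K_def], of "p ! i" "p ! j" "p ! Suc i"] i
          D[of i "Suc i"] D[of "Suc i" j] D[of i j] V[of "Suc i"] by (simp add: S_def)
      then show "i \<in> I H" using i j by (simp add: I_def S_def)
    qed
    moreover have "finite (I H)" by (rule finite_subset[of _ "{..<length p}"]) (auto simp: I_def)
    ultimately have "card (S H - {Max (S H)}) \<le> card (I H)" by (simp add: card_mono)
    then show ?thesis using fS by simp
  qed
  have fin: "finite K" using finite_components by (simp add: K_def)
  have "card M \<le> card J"
  proof -
    have "M \<subseteq> (\<lambda>i. {p ! i, p ! Suc i}) ` J"
    proof
      fix e assume "e \<in> M"
      then obtain i where "Suc i < length p" "e = {p ! i, p ! Suc i}"
        using M by (force simp: path_edges_def set_vwalk_arcs_nth)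
      then show "e \<in> (\<lambda>i. {p ! i, p ! Suc i}) ` J" using \<open>e \<in> M\<close> by (auto simp: J_def)
    qed
    moreover have "finite J" by (rule finite_subset[of _ "{..<length p}"]) (auto simp: J_def)
    ultimately show ?thesis using surj_card_le by blast
  qed
  \<comment> \<open>No edge is counted twice: components are disjoint, and an edge of
    \<open>M\<close> never has both ends in one component.\<close>
  moreover have "card J + (\<Sum>H\<in>K. card (I H)) \<le> n"
  proof -
    have finI: "finite (I H)" for H by (rule finite_subset[of _ "{..<length p}"]) (auto simp: I_def)
    have "I H \<inter> I H' = {}" if "H \<in> K" "H' \<in> K" "H \<noteq> H'" for H H'
      using that component_unique[of H M H'] by (auto simp: I_def K_def)
    then have "card (\<Union>H\<in>K. I H) = (\<Sum>H\<in>K. card (I H))"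
      using fin finI by (intro card_UN_disjoint) auto
    moreover have "J \<inter> (\<Union>H\<in>K. I H) = {}"
      using component_edge(2) adj by (auto simp: J_def I_def K_def)
    moreover have "finite J" by (rule finite_subset[of _ "{..<length p}"]) (auto simp: J_def)
    ultimately have "card J + (\<Sum>H\<in>K. card (I H)) = card (J \<union> (\<Union>H\<in>K. I H))"
      using finI fin by (simp add: card_Un_disjoint)
    also have "\<dots> \<le> card {..<n}" by (rule card_mono) (use n in \<open>auto simp: J_def I_def\<close>)
    finally show ?thesis by simp
  qed
  moreover have "(\<Sum>H\<in>K. vwalk_length (subpath_in p H)) \<le> (\<Sum>H\<in>K. card (I H))"
    using SI by (intro sum_mono) (simp only: len)
  moreover define \<rho> where "\<rho> H = vwalk_length (subpath_in p H) div 2" for H :: "('a, 'b) pre_digraph"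
  have \<rho>: "vwalk_length (subpath_in p H) = 2 * \<rho> H" "0 < \<rho> H" if "H \<in> K" for H
  proof -
    have "x = 2 * (x div 2) \<and> 0 < x div 2" if "even x" "0 < x" for x :: nat using that by presburger
    then show "vwalk_length (subpath_in p H) = 2 * \<rho> H" "0 < \<rho> H"
      using K[OF \<open>H \<in> K\<close>] unfolding \<rho>_def by blast+
  qed
  ultimately have sum: "2 * sum \<rho> K + card M \<le> n"
    by (simp add: sum_distrib_left)
  obtain H0 where H0: "H0 \<in> K" using component_cover[OF V[of 0]] p' by (auto simp: K_def)
  have "1 < length (subpath_in p H0)" using K[OF H0] by simp
  then have "2 \<le> length p" using length_filter_le[of "\<lambda>v. v \<in> verts H0" p]
    unfolding subpath_in_def by linarith
  then show two: "2 \<le> card (verts G)"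
    using card_mono[OF finite_verts p'(3)] distinct_card[OF p'(2)] by simp
  \<comment> \<open>As \<open>H\<close> has even diameter \<open>2 * \<rho> H\<close>, one ball of
    radius \<open>\<rho> H\<close> covers it without rounding; this is where evenness of the
    subpaths is used.\<close>
  have "\<exists>w\<in>verts G. \<forall>v\<in>verts H. D v w \<le> \<rho> H" if H: "H \<in> K" for H
  proof (rule ex_center)
    note H' = H[unfolded K_def]
    show "verts H \<subseteq> verts G" "verts H \<noteq> {}" using component_facts[OF H'] by auto
    fix x y assume xy: "x \<in> verts H" "y \<in> verts H"
    have "diam H = 2 * \<rho> H" using K[OF H] \<rho>[OF H] by (auto simp: diametrical_path_def)
    then show "D x y \<le> 2 * \<rho> H"
      using gdist_le_diam[OF finite_component[OF H'] xy] component_gdist[OF H' xy] by simp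
  qed
  then obtain cen where cen: "\<And>H. H \<in> K \<Longrightarrow> cen H \<in> verts G \<and> (\<forall>v\<in>verts H. D v (cen H) \<le> \<rho> H)"
    by metis
  have "gamma_b G \<le> sum \<rho> K"
  proof (rule gamma_b_le_cover[OF fin two])
    fix v assume "v \<in> verts G"
    then show "\<exists>H\<in>K. D v (cen H) \<le> \<rho> H" using component_cover[of v M] cen by (fastforce simp: K_def)
  qed (use cen \<rho> in blast)
  then show "2 * gamma_b G + card M \<le> diam G" using sum n by simp
qed

end

lemma filter_upt_between:
  assumes "b \<le> N"
  shows "filter (\<lambda>n. a \<le> n \<and> n \<le> b) [0..<Suc N] = [a..<Suc b]"
proof (rule map_sorted_distinct_set_unique[of id])
  show "set (filter (\<lambda>n. a \<le> n \<and> n \<le> b) [0..<Suc N]) = set [a..<Suc b]"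
    using assms by auto
qed (auto simp: sorted_wrt_filter simp del: upt_Suc)

section \<open>The split-set cut out by an incompressible cover\<close>

locale ball_decomposition = utree G + incompressible_cover "verts G" "gdist G" C R
  for G :: "('a, 'b) pre_digraph" (structure) and C R +
  assumes two_balls: "2 \<le> card C"
begin

definition ball :: "'a \<Rightarrow> 'a set" where
  "ball c = {v \<in> verts G. D v c \<le> R c}"

text \<open>Since the balls partition the vertices, these are the edges between different balls,
  that is, the future split-set.\<close>

definition crossing :: "'a set set" where
  "crossing = {{u, v} |u v. u \<rightarrow> v \<and> \<not> (\<exists>c\<in>C. u \<in> ball c \<and> v \<in> ball c)}"

lemma crossing_iff: "u \<rightarrow> v \<Longrightarrow> {u, v} \<in> crossing \<longleftrightarrow> \<not> (\<exists>c\<in>C. u \<in> ball c \<and> v \<in> ball c)"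
  by (auto simp: crossing_def doubleton_eq_iff)

lemma ball_unique:
  assumes "c \<in> C" "c' \<in> C" "v \<in> ball c" "v \<in> ball c'"
  shows "c = c'"
proof (rule ccontr)
  assume "c \<noteq> c'"
  then have "R c + R c' < D c c'" using separated assms by blast
  then show False
    using D_triangle[of c v c'] D_sym[of c v] C_in_V assms by (simp add: ball_def)
qed

text \<open>A geodesic to the centre stays in the ball and has no crossing edge. Conversely, a
  non-crossing edge has both ends in one ball, which by disjointness is the ball it starts
  in.\<close>

lemma ball_component_verts: "c \<in> C \<Longrightarrow> ball c \<in> pre_digraph.sccs_verts (del_edges G crossing)"
proof -
  assume c: "c \<in> C"
  define F where "F = del_edges G crossing"
  interpret F: wf_digraph F using wf_digraph_del_edges wf_digraph by (auto simp: F_def)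
  have F: "arcs_ends F = {(u, v). u \<rightarrow> v \<and> {u, v} \<notin> crossing}" "verts F = verts G"
    by (auto simp: F_def arcs_ends_del_edges) (simp_all add: del_edges_def)
  have "symmetric F"
    unfolding symmetric_def sym_def F using arcs_ends_sym by (auto simp: insert_commute)
  have reach: "v \<rightarrow>\<^sup>*\<^bsub>F\<^esub> c" if "v \<in> ball c" for v
    using that
  proof (induction "D v c" arbitrary: v)
    case 0
    then have "v = c" "v \<in> verts G" using D_eq_0 C_in_V c by (auto simp: ball_def)
    then show ?case using F by simp
  next
    case (Suc n)
    have vV: "v \<in> verts G" "D v c \<le> R c" using Suc by (auto simp: ball_def)
    have "1 \<le> D v c" using Suc by simp
    then obtain w where w: "w \<in> verts G" "D v w = 1" "D v w + D w c = D v c"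
      using geodesic[of v c 1] vV C_in_V c by blast
    then have "w \<in> ball c" "n = D w c" using vV Suc by (auto simp: ball_def)
    moreover have "v \<rightarrow> w" using w vV adj_iff by blast
    ultimately have "(v, w) \<in> arcs_ends F" using F crossing_iff Suc c by blast
    then show ?case using Suc.hyps(1)[of w] \<open>w \<in> ball c\<close> \<open>n = D w c\<close> F.adj_reachable_trans by blast
  qed
  have stay: "v \<in> ball c" if "u \<in> ball c" "u \<rightarrow>\<^sup>*\<^bsub>F\<^esub> v" for u v
    using that(2)
  proof (induction rule: F.reachable_induct)
    case base
    then show ?case using that by simp
  next
    case (step x y)
    then have "x \<rightarrow> y" "{x, y} \<notin> crossing" using F by auto
    then obtain c' where "c' \<in> C" "x \<in> ball c'" "y \<in> ball c'" using crossing_iff by blast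
    then show ?case using ball_unique[of c c' x] step c by simp
  qed
  have "c \<in> ball c" using c C_in_V by (simp add: ball_def)
  moreover have "u \<rightarrow>\<^sup>*\<^bsub>F\<^esub> v" if "u \<in> ball c" "v \<in> ball c" for u v
    using reach[OF that(1)] symmetric_reachable[OF \<open>symmetric F\<close> reach[OF that(2)]]
      F.reachable_trans by blast
  ultimately show ?thesis
    unfolding F_def[symmetric] F.in_sccs_verts_conv_reachable using stay by blast
qed

lemma ball_component:
  assumes "c \<in> C"
  shows "\<exists>H\<in>components (del_edges G crossing). verts H = ball c"
proof -
  interpret F: wf_digraph "del_edges G crossing" using wf_digraph_del_edges wf_digraph by blast
  show ?thesis using ball_component_verts[OF assms] F.sccs_verts_conv by auto
qed

lemma component_ball:
  assumes "H \<in> components (del_edges G crossing)"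
  shows "\<exists>c\<in>C. verts H = ball c"
proof -
  obtain v where v: "v \<in> verts H" "v \<in> verts G" using component_facts(2,3)[OF assms] by blast
  then obtain c where c: "c \<in> C" "v \<in> ball c" using cover by (auto simp: ball_def)
  then obtain H' where "H' \<in> components (del_edges G crossing)" "verts H' = ball c"
    using ball_component by blast
  then show ?thesis using component_unique[OF assms, of H' v] v c by blast
qed

text \<open>On the spanning path the ball of \<open>c\<close> occupies exactly the positions from
  \<open>ix c - R c\<close> to \<open>ix c + R c\<close>, a subpath of length
  \<open>2 * R c\<close>; a ball of radius \<open>R c\<close> has no larger diameter.\<close>

lemma crossing_split_set:
  shows "split_set G crossing"
    and "diam G \<le> 2 * sum R C + card crossing"
    and "\<And>H c. \<lbrakk>H \<in> components (del_edges G crossing); c \<in> C; verts H = ball c\<rbrakk> \<Longrightarrow> diam H = 2 * R c"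
proof -
  obtain pos N where posV: "\<And>n. n \<le> N \<Longrightarrow> pos n \<in> verts G"
    and pos: "\<And>m n. m \<le> n \<Longrightarrow> n \<le> N \<Longrightarrow> D (pos m) (pos n) = n - m"
    and N: "N + 1 = 2 * sum R C + card C"
    and idx: "\<forall>c\<in>C. \<exists>m. pos m = c \<and> R c \<le> m \<and> m + R c \<le> N"
    and far: "\<And>v w. \<lbrakk>v \<in> verts G; w \<in> verts G\<rbrakk> \<Longrightarrow> D v w \<le> N"
    using spanning_path[OF two_balls] by metis
  obtain ix where ix: "\<And>c. c \<in> C \<Longrightarrow> pos (ix c) = c \<and> R c \<le> ix c \<and> ix c + R c \<le> N"
    using idx by metis
  have inj: "pos m = pos n \<longleftrightarrow> m = n" if "m \<le> N" "n \<le> N" for m n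
    using pos[of m n] pos[of n m] posV[OF that(1)] posV[OF that(2)] that D_same
    by (metis diff_is_0_eq le_antisym nle_le)
  have adj: "pos n \<rightarrow> pos (Suc n)" if "n < N" for n
    using pos[of n "Suc n"] posV[of n] posV[of "Suc n"] that adj_iff by simp
  have in_ball: "pos n \<in> ball c \<longleftrightarrow> ix c - R c \<le> n \<and> n \<le> ix c + R c" if "n \<le> N" "c \<in> C" for n c
  proof (cases "n \<le> ix c")
    case True
    then have "D (pos n) c = ix c - n" using pos[of n "ix c"] ix[OF that(2)] by simp
    then show ?thesis using posV[OF that(1)] ix[OF that(2)] True by (auto simp: ball_def)
  next
    case False
    then have "D (pos n) c = n - ix c"
      using pos[of "ix c" n] ix[OF that(2)] that D_sym[of "pos n" c] posV C_in_V by simp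
    then show ?thesis using posV[OF that(1)] ix[OF that(2)] False by (auto simp: ball_def)
  qed
  have diam: "diam G = N"
  proof (rule le_antisym)
    show "diam G \<le> N" using posV[of 0] far by (intro diam_le[OF finite_verts]) auto
    show "N \<le> diam G" using pos[of 0 N] gdist_le_diam[OF finite_verts posV posV, of 0 N] by simp
  qed
  define p where "p = map pos [0..<Suc N]"
  have path_arcs: "set (vwalk_arcs (map pos [a..<Suc b])) = {(pos n, pos (Suc n)) |n. a \<le> n \<and> n < b}"
    for a b
  proof -
    let ?q = "map pos [a..<Suc b]" and ?I = "{i. Suc i < Suc b - a}"
    have "set (vwalk_arcs ?q) = (\<lambda>i. (?q ! i, ?q ! Suc i)) ` ?I"
      unfolding set_vwalk_arcs_nth setcompr_eq_image by (simp del: upt_Suc)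
    also have "\<dots> = (\<lambda>i. (pos (a + i), pos (Suc (a + i)))) ` ?I"
      by (intro image_cong) (auto simp del: upt_Suc)
    also have "\<dots> = {(pos n, pos (Suc n)) |n. a \<le> n \<and> n < b}"
    proof (intro equalityI subsetI)
      fix x assume "x \<in> {(pos n, pos (Suc n)) |n. a \<le> n \<and> n < b}"
      then obtain n where "x = (pos n, pos (Suc n))" "a \<le> n" "n < b" by blast
      then show "x \<in> (\<lambda>i. (pos (a + i), pos (Suc (a + i)))) ` ?I" by (intro image_eqI[of _ _ "n - a"]) auto
    qed fastforce
    finally show ?thesis .
  qed
  have vp: "vpath p G"
    unfolding vpath_def vwalk_def p_def path_arcs
    using posV adj inj by (auto simp: distinct_map inj_on_def simp del: upt_Suc)
  have dp: "diametrical_path G p"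
  proof -
    have "hd p = pos 0" "last p = pos N" "vwalk_length p = N"
      by (simp_all add: p_def hd_map del: upt_Suc) (simp add: p_def)
    then show ?thesis using vp diam pos[of 0 N] by (simp add: diametrical_path_def del: vwalk_length_simp)
  qed
  have crossing_path: "crossing \<subseteq> path_edges p"
  proof
    fix e assume "e \<in> crossing"
    then obtain u v where uv: "e = {u, v}" "u \<rightarrow> v" "\<not> (\<exists>c\<in>C. u \<in> ball c \<and> v \<in> ball c)"
      by (auto simp: crossing_def)
    have *: "{u, v} \<in> path_edges p"
      if a: "a \<in> C" "u \<in> ball a" and b: "b \<in> C" "v \<in> ball b" and less: "ix a < ix b" and uv: "u \<rightarrow> v" "a \<noteq> b"
      for u v a b
    proof -
      have V: "u \<in> verts G" "v \<in> verts G" "a \<in> verts G" "b \<in> verts G"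
        using a b C_in_V by (auto simp: ball_def)
      have le: "D a u \<le> R a" "D v b \<le> R b" "D u v = 1"
        using a b D_sym[of a u] V uv adj_iff by (auto simp: ball_def)
      note ia = ix[OF a(1)] and ib = ix[OF b(1)]
      have Dab: "D a b = ix b - ix a" using pos[of "ix a" "ix b"] ia ib less by simp
      \<comment> \<open>The edge also gives \<open>D a b \<le> R a + 1 + R b\<close>, so all
        triangle inequalities are tight and \<open>u\<close>, \<open>v\<close> lie between
        \<open>a\<close> and \<open>b\<close>, where the spanning path is the only geodesic.\<close>
      have "R a + R b < D a b" using separated a b uv by blast
      then have eq: "D a u = R a" "D v b = R b" "D a b = R a + 1 + R b" "D a v = R a + 1" "D u b = 1 + R b"
        using D_triangle[of a u b] D_triangle[of u v b] D_triangle[of a v b] D_triangle[of a u v] V le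
        by auto
      have k: "ix b = ix a + R a + 1 + R b" using Dab eq less by simp
      have on: "w = pos (ix a + r)"
        if "w \<in> verts G" "D a w = r" "D a w + D w b = D a b" "r \<le> R a + 1" for w r
      proof (rule between_unique[of a b])
        have r: "ix a + r \<le> ix b" "ix b \<le> N" using that(4) k ib by auto
        then show "pos (ix a + r) \<in> verts G" by (intro posV) simp
        have a': "D a (pos (ix a + r)) = r" using pos[of "ix a" "ix a + r"] ia r by auto
        then show "D a w = D a (pos (ix a + r))" using that by simp
        have "D (pos (ix a + r)) b = ix b - (ix a + r)" using pos[of "ix a + r" "ix b"] ib r by auto
        then show "D a (pos (ix a + r)) + D (pos (ix a + r)) b = D a b" using a' r Dab by simp
      qed (use that V in auto)
      have "u = pos (ix a + R a)" using on[of u "R a"] V eq by simp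
      moreover have "v = pos (Suc (ix a + R a))" using on[of v "R a + 1"] V eq by simp
      moreover have "ix a + R a < N" using k ib by simp
      ultimately show ?thesis unfolding path_edges_def p_def path_arcs by auto
    qed
    have V: "u \<in> verts G" "v \<in> verts G" using uv adj_in_verts by auto
    obtain a where a: "a \<in> C" "u \<in> ball a" using cover V by (auto simp: ball_def)
    obtain b where b: "b \<in> C" "v \<in> ball b" using cover V by (auto simp: ball_def)
    have "a \<noteq> b" using a b uv by blast
    then have "ix a \<noteq> ix b" using ix a b by metis
    then show "e \<in> path_edges p"
      using *[OF a b _ uv(2) \<open>a \<noteq> b\<close>] *[OF b a _ arcs_ends_sym[OF uv(2)]] \<open>a \<noteq> b\<close> uv(1)
      by (auto simp: insert_commute neq_iff)
  qed
  have card_crossing: "card C \<le> card crossing + 1"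
  proof -
    obtain c0 where c0: "c0 \<in> C" "pos 0 \<in> ball c0" using cover[OF posV[of 0]] posV[of 0] by (auto simp: ball_def)
    \<comment> \<open>\<open>s c\<close> is the first position in the ball of \<open>c\<close>.
      Every ball except that of \<open>c0\<close>, which holds the start of the path, is entered
      there through a crossing edge; this gives \<open>card C - 1\<close> different edges.\<close>
    define s where "s c = ix c - R c" for c
    define e where "e c = {pos (s c - 1), pos (s c)}" for c
    have s: "0 < s c" "s c \<le> N" "pos (s c) \<in> ball c" "pos (s c - 1) \<notin> ball c" if "c \<in> C - {c0}" for c
    proof -
      have c: "c \<in> C" "c \<noteq> c0" using that by auto
      have "pos 0 \<notin> ball c" using c c0 ball_unique by blast
      then show pos0: "0 < s c" using in_ball[of 0 c] c by (simp add: s_def)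
      show sN: "s c \<le> N" using ix[OF c(1)] unfolding s_def by linarith
      show "pos (s c) \<in> ball c" using in_ball[OF sN c(1)] ix[OF c(1)] by (simp add: s_def)
      show "pos (s c - 1) \<notin> ball c" using in_ball[of "s c - 1" c] c sN pos0 by (simp add: s_def)
    qed
    have "e ` (C - {c0}) \<subseteq> crossing"
    proof
      fix x assume "x \<in> e ` (C - {c0})"
      then obtain c where c: "c \<in> C - {c0}" "x = e c" by blast
      have "pos (s c - 1) \<rightarrow> pos (s c)" using adj[of "s c - 1"] s[OF c(1)] by simp
      then show "x \<in> crossing"
        using crossing_iff[of "pos (s c - 1)" "pos (s c)"] s(3,4)[OF c(1)] c ball_unique
        unfolding e_def by blast
    qed
    moreover have "inj_on e (C - {c0})"
    proof (rule inj_onI)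
      fix c c' assume c: "c \<in> C - {c0}" "c' \<in> C - {c0}" "e c = e c'"
      then have "s c = s c'"
        using s(1,2)[OF c(1)] s(1,2)[OF c(2)] unfolding e_def doubleton_eq_iff
        using inj[of "s c - 1" "s c' - 1"] inj[of "s c" "s c'"] inj[of "s c - 1" "s c'"] inj[of "s c" "s c' - 1"]
        by auto
      then show "c = c'" using s(3)[OF c(1)] s(3)[OF c(2)] c ball_unique by (metis DiffD1)
    qed
    moreover have "finite crossing"
      by (rule finite_subset[of _ "Pow (verts G)"]) (auto simp: crossing_def dest: adj_in_verts)
    ultimately have "card (C - {c0}) \<le> card crossing" using card_inj_on_le by blast
    then show ?thesis using c0 by (simp add: finite_C)
  qed
  have comp: "even (vwalk_length (subpath_in p H)) \<and> 0 < vwalk_length (subpath_in p H) \<and>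
      diametrical_path H (subpath_in p H) \<and> diam H = 2 * R c"
    if H: "H \<in> components (del_edges G crossing)" and c: "c \<in> C" "verts H = ball c" for H c
  proof -
    note facts = component_facts[OF H]
    note ic = ix[OF c(1)]
    define a where "a = ix c - R c"
    define b where "b = ix c + R c"
    have ab: "a \<le> b" "b = a + 2 * R c" "b \<le> N" using ic by (auto simp: a_def b_def)
    have "subpath_in p H = map pos (filter (\<lambda>n. pos n \<in> ball c) [0..<Suc N])"
      by (simp add: subpath_in_def p_def filter_map comp_def c del: upt_Suc)
    also have "filter (\<lambda>n. pos n \<in> ball c) [0..<Suc N] = filter (\<lambda>n. a \<le> n \<and> n \<le> b) [0..<Suc N]"
      using in_ball[OF _ c(1)] by (intro filter_cong) (auto simp: a_def b_def)
    also have "\<dots> = [a..<Suc b]" using filter_upt_between ab by blast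
    finally have sub: "subpath_in p H = map pos [a..<Suc b]" .
    have inH: "pos n \<in> verts H" if "a \<le> n" "n \<le> b" for n
      using in_ball[of n c] that c ab by (simp add: a_def b_def)
    have "hd (subpath_in p H) = pos a" "last (subpath_in p H) = pos b"
      using ab by (simp_all add: sub hd_map last_map del: upt_Suc)
    moreover have len: "vwalk_length (subpath_in p H) = 2 * R c" using ab by (simp add: sub)
    moreover have ends: "gdist H (pos a) (pos b) = 2 * R c"
      using component_gdist[OF H inH inH, of a b] pos[of a b] ab by simp
    moreover have "diam H = 2 * R c"
    proof (rule le_antisym)
      show "diam H \<le> 2 * R c"
      proof (rule diam_le[OF finite_component[OF H] facts(3)])
        fix v w assume vw: "v \<in> verts H" "w \<in> verts H"
        then have "D v w \<le> R c + D c c + R c"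
          using triangle_balls[of c c v w] c C_in_V by (simp add: ball_def)
        then show "gdist H v w \<le> 2 * R c" using component_gdist[OF H vw] C_in_V[OF c(1)] by simp
      qed
      show "2 * R c \<le> diam H"
        using gdist_le_diam[OF finite_component[OF H] inH inH, of a b] ends ab by simp
    qed
    moreover have "vpath (subpath_in p H) H"
    proof -
      have "(pos n, pos (Suc n)) \<in> arcs_ends H" if "a \<le> n" "n < b" for n
        using component_edge(1)[OF H inH inH, of n "Suc n"] adj[of n] that ab by simp
      then show ?thesis
        unfolding vpath_def vwalk_def sub path_arcs
        using inH inj ab by (auto simp: distinct_map inj_on_def simp del: upt_Suc)
    qed
    ultimately show ?thesis using R_pos[OF c(1)] by (simp add: diametrical_path_def del: vwalk_length_simp)
  qed
  show "diam G \<le> 2 * sum R C + card crossing" using card_crossing N diam by simp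
  show "diam H = 2 * R c" if "H \<in> components (del_edges G crossing)" "c \<in> C" "verts H = ball c" for H c
    using comp[OF that] by blast
  have "1 \<le> card crossing" using card_crossing two_balls by simp
  then have "split_set_on G p crossing"
    unfolding split_set_on_def using dp crossing_path comp component_ball by blast
  then show "split_set G crossing" by (auto simp: split_set_def)
qed

end

section \<open>Boundary independent broadcasts\<close>

lemma not_subset_singleton:
  assumes "1 < card S"
  shows "\<not> S \<subseteq> {c}"
proof
  assume "S \<subseteq> {c}"
  then have "card S \<le> card {c}" by (intro card_mono) auto
  then show False using assms by simp
qed

context ball_decomposition
begin

lemma rad_component:
  assumes H: "H \<in> components (del_edges G crossing)" and c: "c \<in> C" "verts H = ball c"
  shows "rad H = R c" "ecc H c \<le> R c"
proof -
  note fin = finite_component[OF H] and facts = component_facts[OF H]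
  have cH: "c \<in> verts H" using c C_in_V by (simp add: ball_def)
  show ecc: "ecc H c \<le> R c"
  proof (rule ecc_le[OF fin cH])
    fix w assume w: "w \<in> verts H"
    then show "gdist H c w \<le> R c"
      using component_gdist[OF H cH w] D_sym[of c w] c C_in_V by (simp add: ball_def)
  qed
  obtain v where v: "v \<in> verts H" "ecc H v = rad H" using ex_rad[OF fin facts(3)] by blast
  have "diam H \<le> 2 * rad H"
  proof (rule diam_le[OF fin facts(3)])
    fix x y assume xy: "x \<in> verts H" "y \<in> verts H"
    have "D x y \<le> D v x + D v y"
      using D_triangle[of x v y] D_sym[of x v] xy v facts(2) by auto
    then show "gdist H x y \<le> 2 * rad H"
      using component_gdist[OF H] xy v gdist_le_ecc[OF fin, of x v] gdist_le_ecc[OF fin, of y v] by simp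
  qed
  then show "rad H = R c"
    using crossing_split_set(3)[OF H c] rad_le_ecc[OF fin cH] ecc by simp
qed

text \<open>On each ball, both the restriction of \<open>f\<close> and the single value
  \<open>R c\<close> at \<open>c\<close> are \<open>gamma_b\<close>-broadcasts of the component,
  hence equal. The restriction costs \<open>R c\<close> since the broadcasting vertices in the ball
  are exactly those merged into it.\<close>

lemma uniquely_radial_imp_eq:
  assumes bf: "broadcast G f" "dominating G f"
    and \<phi>: "\<phi> ` broadcasting G f = C" "R = (\<lambda>c. \<Sum>u | u \<in> broadcasting G f \<and> \<phi> u = c. f u)"
    and nest: "\<forall>u\<in>broadcasting G f. \<forall>v\<in>verts G. D v u \<le> f u \<longrightarrow> D v (\<phi> u) \<le> R (\<phi> u)"
    and ur: "\<And>H. H \<in> components (del_edges G crossing) \<Longrightarrow> uniquely_radial H"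
  shows "\<forall>v\<in>verts G. f v = (if v \<in> C then R v else 0)"
proof -
  define A where "A = broadcasting G f"
  have A: "v \<in> A \<longleftrightarrow> v \<in> verts G \<and> 0 < f v" for v by (auto simp: A_def broadcasting_def)
  have nest': "v \<in> ball (\<phi> u)" "\<phi> u \<in> C" if "u \<in> A" "v \<in> verts G" "D v u \<le> f u" for u v
    using nest \<phi>(1) that by (auto simp: ball_def A_def)
  have finA: "finite A" using finite_verts by (auto simp: A_def broadcasting_def)
  have eq: "(if v \<in> ball c then f v else 0) = (if v = c then R c else 0)" if c: "c \<in> C" for c v
  proof -
    obtain H where H: "H \<in> components (del_edges G crossing)" "verts H = ball c"
      using ball_component c by blast
    note fin = finite_component[OF H(1)] and facts = component_facts[OF H(1)]
    note rad = rad_component[OF H(1) c H(2)]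
    have cH: "c \<in> ball c" using c C_in_V by (simp add: ball_def)
    \<comment> \<open>This rules out the convention that prescribes the value 1 on a one-vertex
      graph.\<close>
    have one: "card (verts H) \<noteq> 1"
    proof
      assume "card (verts H) = 1"
      then obtain x where x: "verts H = {x}" by (rule card_1_singletonE)
      then have "diam H \<le> 0"
        using component_gdist[OF H(1), of x x] facts(2) by (intro diam_le[OF fin]) auto
      then show False using crossing_split_set(3)[OF H(1) c H(2)] R_pos[OF c] by simp
    qed
    have ecc: "R c \<le> ecc H v" "ecc H v \<le> diam H" if "v \<in> verts H" for v
      using rad rad_le_ecc[OF fin that] ecc_le_diam[OF fin that] by auto
    have gam: "gamma_b H = R c" and unique: "\<And>h h'. gamma_b_broadcast H h \<Longrightarrow> gamma_b_broadcast H h' \<Longrightarrow> h = h'"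
      using ur[OF H(1)] rad by (auto simp: uniquely_radial_def radial_def)
    have inball: "v \<in> ball c \<longleftrightarrow> \<phi> v = c" if "v \<in> A" for v
      using nest'[OF that, of v] that A c ball_unique[of "\<phi> v" c v] by auto
    have Rc: "R c = (\<Sum>u | u \<in> A \<and> \<phi> u = c. f u)" using \<phi>(2) by (simp add: A_def)
    have fR: "f v \<le> R c" if v: "v \<in> ball c" for v
    proof (cases "v \<in> A")
      case True
      then show ?thesis unfolding Rc using v inball finA by (intro member_le_sum) auto
    next
      case False
      then show ?thesis using v A by (auto simp: ball_def)
    qed
    define h where "h v = (if v \<in> ball c then f v else 0)" for v
    define h' where "h' v = (if v = c then R c else 0)" for v
    have "gamma_b_broadcast H h"
      unfolding gamma_b_broadcast_def
    proof (intro conjI)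
      show "broadcast H h"
        using one fR ecc le_trans unfolding broadcast_def h_def H(2) by (simp, meson le_trans)
      show "dominating H h"
        unfolding dominating_def
      proof
        fix u assume u: "u \<in> verts H"
        then have uG: "u \<in> verts G" "u \<in> ball c" using facts(2) H by auto
        then obtain v where v: "v \<in> A" "D u v \<le> f v"
          using bf(2) by (auto simp: dominating_def hears_from_def A_def)
        then have "u \<in> ball (\<phi> v)" "\<phi> v \<in> C" using nest' uG by auto
        then have "\<phi> v = c" using ball_unique c uG by blast
        then have "v \<in> ball c" using inball v by blast
        then have "hears_from H h u v"
          using v A component_gdist[OF H(1) u, of v] H(2) by (simp add: hears_from_def broadcasting_def h_def)
        then show "\<exists>v. hears_from H h u v" ..
      qed
      have "cost H h = sum f (ball c)" by (simp add: cost_def H h_def)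
      also have "\<dots> = R c"
        unfolding Rc using fin H inball A by (intro sum.mono_neutral_right) (auto simp: ball_def)
      finally show "cost H h = gamma_b H" using gam by simp
    qed
    moreover have "gamma_b_broadcast H h'"
      unfolding gamma_b_broadcast_def
    proof (intro conjI)
      show "broadcast H h'"
        using one cH ecc[of c] H(2) by (auto simp: broadcast_def h'_def)
      show "dominating H h'"
        unfolding dominating_def
      proof
        fix u assume u: "u \<in> verts H"
        then have "hears_from H h' u c"
          using component_gdist[OF H(1) u, of c] H(2) cH R_pos[OF c]
          by (simp add: hears_from_def broadcasting_def h'_def ball_def)
        then show "\<exists>v. hears_from H h' u v" ..
      qed
      show "cost H h' = gamma_b H" using gam fin cH H(2) by (simp add: cost_def h'_def)
    qed
    ultimately have "h v = h' v" using unique by metis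
    then show ?thesis by (simp add: h_def h'_def)
  qed
  show ?thesis
  proof
    fix v assume v: "v \<in> verts G"
    then obtain c where c: "c \<in> C" "v \<in> ball c" using cover by (auto simp: ball_def)
    have "f v = (if v = c then R c else 0)" using eq[OF c(1), of v] c(2) by simp
    moreover have "v \<in> C \<longleftrightarrow> v = c"
      using ball_unique[of v c v] c v by (auto simp: ball_def)
    ultimately show "f v = (if v \<in> C then R v else 0)" by simp
  qed
qed

text \<open>
  Raising a centre by one adds to its ball only vertices of the boundary of another ball, hence keeps
  the broadcast bn-independent.
\<close>

lemma disjoint_balls_not_maximal:
  assumes bf: "broadcast G f" and f: "\<forall>v\<in>verts G. f v = (if v \<in> C then R v else 0)"
    and two: "2 \<le> card (verts G)"
  shows "\<not> maximal_bn_independent G f"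
proof -
  obtain c where c: "c \<in> C" using two_balls by fastforce
  have "\<not> C \<subseteq> {c}" using two_balls by (intro not_subset_singleton) simp
  then obtain c' where c': "c' \<in> C" "c' \<noteq> c" by blast
  have cV: "c \<in> verts G" "c' \<in> verts G" using c c' C_in_V by auto
  define g where "g = f(c := R c + 1)"
  have gC: "g v = (if v \<in> C then R v + (if v = c then 1 else 0) else 0)" if "v \<in> verts G" for v
    using f that c by (simp add: g_def)
  have Dc: "R c + R a < D c a" if "a \<in> C" "a \<noteq> c" for a using separated c that by blast
  \<comment> \<open>There is room for the increment, because another centre lies further than
    \<open>R c\<close> away.\<close>
  have "R c + 1 \<le> ecc G c"
    using Dc[OF c'] gdist_le_ecc[OF finite_verts cV(2), of c] by simp
  then have bg: "broadcast G g"
    using bf two ecc_le_diam[OF finite_verts cV(1)] cV by (auto simp: broadcast_def g_def)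
  have hears: "hears_from G g x v \<longleftrightarrow> v \<in> C \<and> D x v \<le> g v" for x v
    using gC C_in_V R_pos by (auto simp: hears_from_def broadcasting_def split: if_splits)
  have "bn_independent G g"
    unfolding bn_independent_def
  proof (intro conjI bg ballI impI)
    fix x u assume x: "x \<in> verts G" and card: "1 < card {v. hears_from G g x v}"
      and u: "u \<in> broadcasting G g"
    have uC: "u \<in> C" "u \<in> verts G" using u gC by (auto simp: broadcasting_def split: if_splits)
    have out: "R b < D x b" if "x \<in> ball a" "a \<in> C" "b \<in> C" "a \<noteq> b" for a b
      using ball_unique[of a b x] that x unfolding ball_def by fastforce
    obtain a where a: "a \<in> C" "a \<noteq> c" "D x a \<le> g a"
      using hears not_subset_singleton[OF card, of c] by auto
    then have xa: "x \<in> ball a" using x gC C_in_V by (auto simp: ball_def)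
    obtain b where b: "b \<in> C" "b \<noteq> a" "D x b \<le> g b"
      using hears not_subset_singleton[OF card, of a] by auto
    have "b = c"
    proof (rule ccontr)
      assume "b \<noteq> c"
      then have "x \<in> ball b" using b x gC C_in_V by (auto simp: ball_def)
      then show False using ball_unique a b xa by blast
    qed
    then have xc: "D x c \<le> R c + 1" using b gC cV c by simp
    show "g u \<le> D x u"
    proof (cases "u = a")
      case True
      \<comment> \<open>With \<open>R c + R a < D c a\<close> and \<open>D x c \<le> R c + 1\<close>
        this yields \<open>R a \<le> D x a\<close>: \<open>x\<close> is on the boundary of the ball
        of \<open>a\<close>.\<close>
      have "D c a \<le> D x c + D x a"
        using D_triangle[of c x a] D_sym[of c x] x a C_in_V cV by simp
      then show ?thesis using True Dc[of a] a xc gC uC by simp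
    next
      case False
      \<comment> \<open>The strict inequality in \<open>out\<close> absorbs the increment when
        \<open>u = c\<close>.\<close>
      then show ?thesis using out[OF xa a(1) uC(1)] gC uC by auto
    qed
  qed
  moreover have "g \<noteq> f" using f cV c by (metis fun_upd_same g_def less_add_one less_irrefl)
  moreover have "\<forall>v\<in>verts G. f v \<le> g v" using f c by (auto simp: g_def)
  ultimately show ?thesis by (auto simp: maximal_bn_independent_def)
qed

end

section \<open>Domination, the central broadcast and the comparison of costs\<close>

context utree
begin

text \<open>An unheard vertex \<open>x\<close> could broadcast with strength 1. Only its neighbours
  newly hear something, and since every \<open>u\<close> in the broadcast satisfies
  \<open>f u < D x u\<close>, they satisfy \<open>f u \<le> D y u\<close>.\<close>

lemma maximal_bn_independent_dominating:
  assumes max: "maximal_bn_independent G f" and two: "2 \<le> card (verts G)"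
  shows "dominating G f"
proof (rule ccontr)
  assume "\<not> dominating G f"
  then obtain x where x: "x \<in> verts G" "\<And>v. \<not> hears_from G f x v" by (auto simp: dominating_def)
  have bn: "bn_independent G f" using max by (simp add: maximal_bn_independent_def)
  have far: "f u < D x u" if "u \<in> broadcasting G f" for u
    using x(2)[of u] that by (simp add: hears_from_def)
  have fx: "f x = 0" using x(2)[of x] x(1) by (auto simp: hears_from_def broadcasting_def)
  define g where "g = f(x := 1)"
  have bc: "broadcasting G g = insert x (broadcasting G f)"
    using x by (auto simp: broadcasting_def g_def)
  have xbc: "x \<notin> broadcasting G f" using fx by (simp add: broadcasting_def)
  have "broadcast G g"
    using bn ecc_pos[OF two x(1)] ecc_le_diam[OF finite_verts x(1)] two x(1)
    by (auto simp: bn_independent_def broadcast_def g_def)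
  moreover have "g u \<le> D y u"
    if y: "y \<in> verts G" and card: "1 < card {v. hears_from G g y v}" and u: "u \<in> broadcasting G g" for y u
  proof -
    have sets: "{v. hears_from G g y v} =
        {v. hears_from G f y v} \<union> (if D y x \<le> 1 then {x} else {})"
      unfolding hears_from_def bc using xbc by (auto simp: g_def)
    show ?thesis
    proof (cases "D y x \<le> 1")
      case False
      then have "1 < card {v. hears_from G f y v}" using sets card by simp
      then show ?thesis using bn u y False xbc unfolding bn_independent_def bc by (auto simp: g_def)
    next
      case True
      have "y \<noteq> x"
      proof
        assume "y = x"
        then have "{v. hears_from G g y v} \<subseteq> {x}" using sets x by auto
        then show False using not_subset_singleton[OF card] by blast
      qed
      then have "D y x = 1" using True D_eq_0[of y x] x y by auto
      moreover have "f u \<le> D y u" if "u \<noteq> x"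
      proof -
        have "u \<in> broadcasting G f" using u bc that by simp
        moreover from this have "u \<in> verts G" by (simp add: broadcasting_def)
        ultimately show ?thesis
          using far[of u] D_triangle[of x y u] D_sym[of x y] x y \<open>D y x = 1\<close> by fastforce
      qed
      ultimately show ?thesis by (simp add: g_def)
    qed
  qed
  ultimately have "bn_independent G g" by (auto simp: bn_independent_def)
  moreover have "g \<noteq> f" using fx by (auto simp: g_def fun_eq_iff)
  moreover have "\<forall>v\<in>verts G. f v \<le> g v" using fx by (simp add: g_def)
  ultimately show False using max by (auto simp: maximal_bn_independent_def)
qed

text \<open>With one broadcasting vertex the independence condition is vacuous. The value at
  \<open>c\<close> is already its eccentricity, and a second broadcasting vertex \<open>u\<close>
  would hear both \<open>c\<close> and itself, at distance 0 from itself.\<close>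

lemma ex_central_broadcast:
  assumes two: "2 \<le> card (verts G)"
  shows "\<exists>f. maximal_bn_independent G f \<and> cost G f = rad G"
proof -
  have "verts G \<noteq> {}" using two by auto
  then obtain c where c: "c \<in> verts G" "ecc G c = rad G" using ex_rad[OF finite_verts] by blast
  define f where "f v = (if v = c then rad G else 0)" for v
  have pos: "0 < rad G" using ecc_pos[OF two c(1)] c by simp
  have "broadcast G f"
    using two c ecc_le_diam[OF finite_verts c(1)] by (auto simp: broadcast_def f_def)
  moreover have "broadcasting G f = {c}" using c pos by (auto simp: broadcasting_def f_def)
  then have "{v. hears_from G f x v} \<subseteq> {c}" for x by (auto simp: hears_from_def)
  then have "\<not> 1 < card {v. hears_from G f x v}" for x
    using not_subset_singleton[of "{v. hears_from G f x v}" c] by auto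
  ultimately have "bn_independent G f" by (simp add: bn_independent_def)
  moreover have "g = f" if g: "bn_independent G g" "\<forall>v\<in>verts G. f v \<le> g v" for g
  proof
    have bg: "broadcast G g" using g by (simp add: bn_independent_def)
    have gc: "g c = rad G" using bg g(2) c two by (force simp: broadcast_def f_def)
    fix u
    show "g u = f u"
    proof (rule ccontr)
      assume neq: "g u \<noteq> f u"
      have "u \<noteq> c" using neq gc by (auto simp: f_def)
      moreover have "\<forall>v. v \<notin> verts G \<longrightarrow> g v = 0" using bg by (simp add: broadcast_def)
      ultimately have u: "u \<in> verts G" "u \<noteq> c" using neq by (auto simp: f_def)
      have gu: "0 < g u" using neq u by (simp add: f_def)
      have "D u c \<le> rad G" using gdist_le_ecc[OF finite_verts u(1), of c] D_sym[of u c] u c by simp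
      then have "{c, u} \<subseteq> {v. hears_from G g u v}"
        using gc gu pos u c by (simp add: hears_from_def broadcasting_def)
      moreover have "finite {v. hears_from G g u v}"
        by (rule finite_subset[OF _ finite_verts]) (auto simp: hears_from_def broadcasting_def)
      ultimately have "card {c, u} \<le> card {v. hears_from G g u v}" by (rule card_mono[rotated])
      then have "1 < card {v. hears_from G g u v}" using u by simp
      then have "\<forall>w\<in>broadcasting G g. g w \<le> D u w"
        using g(1) u unfolding bn_independent_def by blast
      then show False using gu u by (auto simp: broadcasting_def)
    qed
  qed
  moreover have "cost G f = rad G" using c by (simp add: cost_def f_def)
  ultimately show ?thesis by (auto simp: maximal_bn_independent_def)
qed

lemma rad_le_half_diam:
  assumes "verts G \<noteq> {}"
  shows "2 * rad G \<le> diam G + 1"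
proof -
  have "D x y \<le> 2 * ((diam G + 1) div 2)" if "x \<in> verts G" "y \<in> verts G" for x y
    using gdist_le_diam[OF finite_verts that] by linarith
  then obtain w where w: "w \<in> verts G" "\<forall>x\<in>verts G. D x w \<le> (diam G + 1) div 2"
    using ex_center[of "verts G" "(diam G + 1) div 2"] assms by blast
  have "ecc G w \<le> (diam G + 1) div 2"
  proof (rule ecc_le[OF finite_verts w(1)])
    fix x assume "x \<in> verts G"
    then show "D w x \<le> (diam G + 1) div 2" using w D_sym[of w x] by simp
  qed
  then show ?thesis using rad_le_ecc[OF finite_verts w(1)] by simp
qed

lemma diam_le_twice_rad:
  assumes "verts G \<noteq> {}"
  shows "diam G \<le> 2 * rad G"
proof (rule diam_le[OF finite_verts assms])
  obtain c where c: "c \<in> verts G" "ecc G c = rad G" using ex_rad[OF finite_verts assms] by blast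
  fix v w assume vw: "v \<in> verts G" "w \<in> verts G"
  then show "D v w \<le> 2 * rad G"
    using D_triangle[of v c w] D_sym[of v c] c gdist_le_ecc[OF finite_verts, of v c]
      gdist_le_ecc[OF finite_verts, of w c] by simp
qed

text \<open>The two cases are one remaining ball and several. The map \<open>\<phi>\<close> is kept
  in the second case because \<open>uniquely_radial_imp_eq\<close> must know which vertices were
  merged.\<close>

lemma dominating_broadcast_cases:
  assumes f: "dominating G f" and ne: "verts G \<noteq> {}"
  obtains "rad G \<le> cost G f"
  | \<phi> C R where "ball_decomposition G C R" "sum R C = cost G f" "\<phi> ` broadcasting G f = C"
    "R = (\<lambda>c. \<Sum>u | u \<in> broadcasting G f \<and> \<phi> u = c. f u)"
    "\<forall>u\<in>broadcasting G f. \<forall>v\<in>verts G. D v u \<le> f u \<longrightarrow> D v (\<phi> u) \<le> R (\<phi> u)"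
proof -
  define A where "A = broadcasting G f"
  have A: "A \<subseteq> verts G" "\<And>u. u \<in> A \<Longrightarrow> 0 < f u" by (auto simp: A_def broadcasting_def)
  have cov: "\<exists>u\<in>A. D v u \<le> f u" if "v \<in> verts G" for v
    using f that by (auto simp: dominating_def hears_from_def A_def)
  have "\<exists>\<phi> R. R = (\<lambda>c. \<Sum>u | u \<in> A \<and> \<phi> u = c. f u) \<and>
      incompressible_cover (verts G) D (\<phi> ` A) R \<and>
      (\<forall>u\<in>A. \<forall>v\<in>verts G. D v u \<le> f u \<longrightarrow> D v (\<phi> u) \<le> R (\<phi> u))"
    using A cov by (rule ex_incompressible_coarsening)
  then obtain \<phi> R where \<phi>: "R = (\<lambda>c. \<Sum>u | u \<in> A \<and> \<phi> u = c. f u)"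
      "incompressible_cover (verts G) D (\<phi> ` A) R"
      "\<forall>u\<in>A. \<forall>v\<in>verts G. D v u \<le> f u \<longrightarrow> D v (\<phi> u) \<le> R (\<phi> u)"
    by (elim exE conjE) (rule that)
  interpret cov: incompressible_cover "verts G" D "\<phi> ` A" R by (rule \<phi>)
  have finA: "finite A" using A finite_subset finite_verts by blast
  have "sum R (\<phi> ` A) = sum f A" unfolding \<phi>(1) using finA by (intro sum.group) auto
  also have "\<dots> = cost G f"
    unfolding cost_def using A(1) by (intro sum.mono_neutral_left) (auto simp: A_def broadcasting_def)
  finally have sum: "sum R (\<phi> ` A) = cost G f" .
  obtain v where "v \<in> verts G" using ne by blast
  then have "\<phi> ` A \<noteq> {}" using cov.cover by blast
  then have "card (\<phi> ` A) \<noteq> 0" using finA by simp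
  then consider "card (\<phi> ` A) = 1" | "2 \<le> card (\<phi> ` A)" by linarith
  then show ?thesis
  proof cases
    case 1
    then obtain c where c: "\<phi> ` A = {c}" by (rule card_1_singletonE)
    have cV: "c \<in> verts G" using cov.C_in_V c by blast
    have "ecc G c \<le> cost G f"
    proof (rule ecc_le[OF finite_verts cV])
      fix w assume w: "w \<in> verts G"
      then have "D w c \<le> R c" using cov.cover c by auto
      then show "D c w \<le> cost G f" using sum c D_sym[OF cV w] by simp
    qed
    then show ?thesis using that(1) rad_le_ecc[OF finite_verts cV] by simp
  next
    case 2
    have "ball_decomposition G (\<phi> ` A) R" by unfold_locales (rule 2)
    then show ?thesis using that(2)[of "\<phi> ` A" R \<phi>] sum \<phi> unfolding A_def by blast
  qed
qed

lemma i_bn_eq_gamma_b_plus_1: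
  assumes M0: "maximum_split_set G M0" "card M0 \<le> 2"
    and ur: "\<And>M H. \<lbrakk>maximum_split_set G M; H \<in> components (del_edges G M)\<rbrakk> \<Longrightarrow> uniquely_radial H"
  shows "i_bn G = gamma_b G + 1"
proof -
  have split: "split_set G M0" and max: "\<And>M. split_set G M \<Longrightarrow> card M \<le> card M0"
    using M0 by (auto simp: maximum_split_set_def)
  have two: "2 \<le> card (verts G)" and bound: "2 * gamma_b G + card M0 \<le> diam G"
    using split_set_bound[OF split] by auto
  have pos: "1 \<le> card M0" using split by (auto simp: split_set_def split_set_on_def)
  have ne: "verts G \<noteq> {}" using two by auto
  obtain f0 where f0: "maximal_bn_independent G f0" "cost G f0 = rad G"
    using ex_central_broadcast[OF two] by blast
  have dom_bc: "broadcast G f \<and> dominating G f" if "maximal_bn_independent G f" for f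
    using that maximal_bn_independent_dominating[OF that two]
    by (simp add: maximal_bn_independent_def bn_independent_def)
  have "\<exists>c f. broadcast G f \<and> dominating G f \<and> cost G f = c" using dom_bc[OF f0(1)] by blast
  then have "\<exists>f. broadcast G f \<and> dominating G f \<and> cost G f = gamma_b G"
    unfolding gamma_b_def by (rule LeastI_ex)
  then obtain h where h: "broadcast G h" "dominating G h" "cost G h = gamma_b G" by blast
  have "rad G \<le> gamma_b G + 1"
  proof (rule dominating_broadcast_cases[OF h(2) ne])
    fix \<phi> C R assume "ball_decomposition G C R" and sum: "sum R C = cost G h"
    then interpret ball_decomposition G C R by simp
    \<comment> \<open>Hence \<open>2 * rad G \<le> 2 * gamma_b G + 3\<close>, and rounding gives the
      claim; three crossing edges would give only \<open>gamma_b G + 2\<close>.\<close>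
    have "diam G \<le> 2 * gamma_b G + 2"
      using crossing_split_set(2) max[OF crossing_split_set(1)] M0 sum h by simp
    then show ?thesis using rad_le_half_diam[OF ne] by simp
  qed (use h in simp)
  moreover have "i_bn G \<le> rad G" unfolding i_bn_def using f0 by (intro Least_le) blast
  moreover have "gamma_b G < i_bn G"
  proof (rule ccontr)
    assume "\<not> gamma_b G < i_bn G"
    then have le: "i_bn G \<le> gamma_b G" by simp
    have "\<exists>c f. maximal_bn_independent G f \<and> cost G f = c" using f0 by blast
    then have "\<exists>f. maximal_bn_independent G f \<and> cost G f = i_bn G"
      unfolding i_bn_def by (rule LeastI_ex)
    then obtain f where f: "maximal_bn_independent G f" "cost G f \<le> gamma_b G" using le by auto
    have bf: "broadcast G f" "dominating G f" using dom_bc[OF f(1)] by auto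
    show False
    proof (rule dominating_broadcast_cases[OF bf(2) ne])
      assume "rad G \<le> cost G f"
      \<comment> \<open>Otherwise \<open>2 * gamma_b G + 1 \<le> diam G \<le> 2 * rad G \<le> 2 *
        gamma_b G\<close>.\<close>
      then show False using f(2) bound pos diam_le_twice_rad[OF ne] by simp
    next
      fix \<phi> C R assume bd: "ball_decomposition G C R" and sum: "sum R C = cost G f"
        and \<phi>: "\<phi> ` broadcasting G f = C" "R = (\<lambda>c. \<Sum>u | u \<in> broadcasting G f \<and> \<phi> u = c. f u)"
        "\<forall>u\<in>broadcasting G f. \<forall>v\<in>verts G. D v u \<le> f u \<longrightarrow> D v (\<phi> u) \<le> R (\<phi> u)"
      interpret ball_decomposition G C R by (rule bd)
      \<comment> \<open>Here \<open>2 * gamma_b G + card M \<le> diam G \<le> 2 * cost G f + card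
        crossing\<close>, and \<open>cost G f \<le> gamma_b G\<close>.\<close>
      have "card M \<le> card crossing" if "split_set G M" for M
        using split_set_bound(1)[OF that] crossing_split_set(2) sum f(2) by simp
      then have "maximum_split_set G crossing"
        using crossing_split_set(1) by (simp add: maximum_split_set_def)
      then have "\<forall>v\<in>verts G. f v = (if v \<in> C then R v else 0)"
        using ur by (intro uniquely_radial_imp_eq[OF bf \<phi>]) blast
      then show False using disjoint_balls_not_maximal[OF bf(1) _ two] f(1) by blast
    qed
  qed
  ultimately show ?thesis by simp
qed

end

theorem theorem2p6:
  fixes T :: "('a, 'b) pre_digraph" and m :: nat
  assumes "undirected_tree T"
    and "\<exists>M. maximum_split_set T M \<and> card M = m"
    and "m \<in> {1, 2}"
    and "\<And>M H. maximum_split_set T M \<Longrightarrow> H \<in> components (del_edges T M) \<Longrightarrow> uniquely_radial H"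
  shows "i_bn T = gamma_b T + 1"
proof -
  interpret utree T using assms(1) by (rule undirected_tree_utree)
  obtain M where "maximum_split_set T M" "card M \<le> 2" using assms(2,3) by auto
  then show ?thesis using assms(4) by (rule i_bn_eq_gamma_b_plus_1)
qed

end
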